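(* Let $0<\alpha\le 1$, $\beta>0$, and let $u$ be a smooth positive solution to $$u_t=\Delta(u^\beta)\ \text{ in }\Omega,\ t>0,\qquad \nabla(u^\beta)\cdot\nu=0\ \text{ on }\partial\Omega,\ t>0,\qquad u(\cdot,0)=u_0\ \text{ in }\Omega,$$ where $u_0\in L^\infty(\Omega)$ with $\inf_\Omega u_0\ge 0$. Then $$E_\alpha[u(t)]\le E_\alpha[u_0]\,e^{-\Lambda t},\qquad t\ge 0,$$ holds with $$\Lambda=\frac{4\alpha\beta}{C_B(\tfrac12(\alpha+1),2)\,(\alpha+1)}\,\inf_\Omega\big(u_0^{\beta-1}\big)\ge 0\qquad\text{for } \beta>0,$$ and also with $$\Lambda=\frac{4\alpha\beta(\alpha+1)}{C_B'(p,q)(\alpha+\beta)^2}\,\|u_0\|_{L^1(\Omega)}^{\beta-1}\qquad\text{for } \beta>1,$$ where $p=(\alpha+\beta)/2$ and $q=2(\alpha+1)/(\alpha+\beta)$.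
   Context: $\Omega\subset\mathbb{R}^d$ ($d\ge1$) is a bounded domain with Lebesgue measure $\mathrm{m}(\Omega)=1$, with unit exterior normal $\nu$ on $\partial\Omega$, such that the Poincaré-Wirtinger inequality $\|f-\bar f\|_{L^2(\Omega)}\le C_P\|\nabla f\|_{L^2(\Omega)}$ holds for all $f\in H^1(\Omega)$, where $\bar f=\int_\Omega f\,dx$ and $C_P>0$ depends only on $d$ and $\Omega$. The zeroth-order entropy is $$E_\alpha[u]=\frac{1}{\alpha+1}\left(\int_\Omega u^{\alpha+1}\,dx-\Big(\int_\Omega u\,dx\Big)^{\alpha+1}\right).$$ The constants are $C_B(\tfrac12(\alpha+1),2)=C_P^2$, and $C_B'(p,q)=\frac{q(pq-1)C_P^2}{2-q}$ if $1\le q<2$, $C_B'(p,q)=(pq-1)C_P^2$ if $0<q<1$. Throughout, solutions are assumed smooth and positive, so that all computations and integrations by parts are justified (including up to the initial time $t=0$), and the maximum principle $\inf_\Omega u_0\le u(t)\le\sup_\Omega u_0$ holds. *)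

theory Defs
  imports "HOL-Analysis.Analysis"
begin

primrec Ck_on :: "nat \<Rightarrow> 'a::euclidean_space set \<Rightarrow> ('a \<Rightarrow> 'b::real_normed_vector) \<Rightarrow> bool" where
  "Ck_on 0 S f \<longleftrightarrow> continuous_on S f"
| "Ck_on (Suc k) S f \<longleftrightarrow> (\<forall>x\<in>S. f differentiable (at x)) \<and>
     (\<forall>b\<in>Basis. Ck_on k S (\<lambda>x. frechet_derivative f (at x) b))"

definition smooth_on :: "'a::euclidean_space set \<Rightarrow> ('a \<Rightarrow> 'b::real_normed_vector) \<Rightarrow> bool" where
  "smooth_on S f \<longleftrightarrow> (\<forall>k. Ck_on k S f)"

definition grad :: "('a::euclidean_space \<Rightarrow> real) \<Rightarrow> 'a \<Rightarrow> 'a" where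
  "grad f x = (\<Sum>b\<in>Basis. frechet_derivative f (at x) b *\<^sub>R b)"

definition divergence :: "('a::euclidean_space \<Rightarrow> 'a) \<Rightarrow> 'a \<Rightarrow> real" where
  "divergence F x = (\<Sum>b\<in>Basis. frechet_derivative F (at x) b \<bullet> b)"

definition laplacian :: "('a::euclidean_space \<Rightarrow> real) \<Rightarrow> 'a \<Rightarrow> real" where
  "laplacian f = divergence (grad f)"

definition bounded_domain :: "'a::euclidean_space set \<Rightarrow> bool" where
  "bounded_domain \<Omega> \<longleftrightarrow> \<Omega> \<noteq> {} \<and> open \<Omega> \<and> connected \<Omega> \<and> bounded \<Omega>"

text \<open>The boundary has a tangent hyperplane at \<open>x\<close> with unit normal \<open>n\<close>: near \<open>x\<close>, points
  strictly on the side of \<open>n\<close> (up to arbitrarily thin cones around the hyperplane) lie outside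
  \<open>\<Omega>\<close>, points on the opposite side inside. For a Lipschitz domain such an \<open>n\<close> exists
  at almost every boundary point.\<close>

definition exterior_normal_at :: "'a::euclidean_space set \<Rightarrow> 'a \<Rightarrow> 'a \<Rightarrow> bool" where
  "exterior_normal_at \<Omega> x n \<longleftrightarrow> norm n = 1 \<and>
     (\<forall>\<epsilon>>0. \<exists>\<delta>>0. \<forall>y. norm (y - x) < \<delta> \<longrightarrow>
        ((y - x) \<bullet> n > \<epsilon> * norm (y - x) \<longrightarrow> y \<notin> \<Omega>) \<and>
        ((y - x) \<bullet> n < - \<epsilon> * norm (y - x) \<longrightarrow> y \<in> \<Omega>))"

text \<open>\<open>\<sigma>\<close> is the surface measure on the boundary and \<open>\<nu>\<close> the unit exterior normal field,
  defined \<open>\<sigma>\<close>-almost everywhere (so that corners are allowed). The last clause is the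
  divergence theorem, i.e. the domain is one in which integration by parts is justified; in the
  sense of De Giorgi it says that \<open>\<nu> \<sigma>\<close> is minus the distributional gradient of the indicator
  function of \<open>\<Omega>\<close>, so \<open>\<sigma>\<close> is determined by \<open>\<Omega>\<close>, and so is \<open>\<nu>\<close> up to \<open>\<sigma>\<close>-null sets.\<close>

definition unit_exterior_normal ::
    "'a::euclidean_space set \<Rightarrow> 'a measure \<Rightarrow> ('a \<Rightarrow> 'a) \<Rightarrow> bool" where
  "unit_exterior_normal \<Omega> \<sigma> \<nu> \<longleftrightarrow>
     finite_measure \<sigma> \<and> sets \<sigma> = sets borel \<and> \<nu> \<in> borel_measurable borel \<and>
     (AE x in \<sigma>. x \<in> frontier \<Omega> \<and> exterior_normal_at \<Omega> x (\<nu> x)) \<and>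
     (\<forall>W F. open W \<and> closure \<Omega> \<subseteq> W \<and> Ck_on 1 W F \<longrightarrow>
        (LINT x|lebesgue_on \<Omega>. divergence F x) = (LINT x|\<sigma>. F x \<bullet> \<nu> x))"

definition L2_on :: "'a::euclidean_space set \<Rightarrow> ('a \<Rightarrow> 'b::euclidean_space) \<Rightarrow> bool" where
  "L2_on \<Omega> f \<longleftrightarrow> f \<in> borel_measurable (lebesgue_on \<Omega>) \<and>
     integrable (lebesgue_on \<Omega>) (\<lambda>x. (norm (f x))\<^sup>2)"

definition L2_norm_on :: "'a::euclidean_space set \<Rightarrow> ('a \<Rightarrow> 'b::euclidean_space) \<Rightarrow> real" where
  "L2_norm_on \<Omega> f = sqrt (LINT x|lebesgue_on \<Omega>. (norm (f x))\<^sup>2)"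

definition Linf_on :: "'a::euclidean_space set \<Rightarrow> ('a \<Rightarrow> real) \<Rightarrow> bool" where
  "Linf_on \<Omega> f \<longleftrightarrow> f \<in> borel_measurable (lebesgue_on \<Omega>) \<and>
     (\<exists>C. AE x in lebesgue_on \<Omega>. \<bar>f x\<bar> \<le> C)"

definition test_function :: "'a::euclidean_space set \<Rightarrow> ('a \<Rightarrow> real) \<Rightarrow> bool" where
  "test_function \<Omega> \<phi> \<longleftrightarrow> smooth_on UNIV \<phi> \<and>
     compact (closure {x. \<phi> x \<noteq> 0}) \<and> closure {x. \<phi> x \<noteq> 0} \<subseteq> \<Omega>"

definition weak_gradient :: "'a::euclidean_space set \<Rightarrow> ('a \<Rightarrow> real) \<Rightarrow> ('a \<Rightarrow> 'a) \<Rightarrow> bool" where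
  "weak_gradient \<Omega> f g \<longleftrightarrow> (\<forall>\<phi>. test_function \<Omega> \<phi> \<longrightarrow> (\<forall>b\<in>Basis.
     (LINT x|lebesgue_on \<Omega>. f x * frechet_derivative \<phi> (at x) b) =
     - (LINT x|lebesgue_on \<Omega>. (g x \<bullet> b) * \<phi> x)))"

text \<open>\<open>f\<close> belongs to the Sobolev space \<open>H\<^sup>1(\<Omega>)\<close>, with (a.e. unique) weak gradient \<open>g\<close>.\<close>

definition H1_with_gradient :: "'a::euclidean_space set \<Rightarrow> ('a \<Rightarrow> real) \<Rightarrow> ('a \<Rightarrow> 'a) \<Rightarrow> bool" where
  "H1_with_gradient \<Omega> f g \<longleftrightarrow> L2_on \<Omega> f \<and> L2_on \<Omega> g \<and> weak_gradient \<Omega> f g"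

text \<open>The mean is not normalised by the volume, since only domains of measure 1 are considered.\<close>

definition poincare_wirtinger :: "'a::euclidean_space set \<Rightarrow> real \<Rightarrow> bool" where
  "poincare_wirtinger \<Omega> C \<longleftrightarrow> (\<forall>f g. H1_with_gradient \<Omega> f g \<longrightarrow>
     L2_norm_on \<Omega> (\<lambda>x. f x - (LINT y|lebesgue_on \<Omega>. f y)) \<le> C * L2_norm_on \<Omega> g)"

definition entropy :: "'a::euclidean_space set \<Rightarrow> real \<Rightarrow> ('a \<Rightarrow> real) \<Rightarrow> real" where
  "entropy \<Omega> \<alpha> w = 1 / (\<alpha> + 1) *
     ((LINT x|lebesgue_on \<Omega>. w x powr (\<alpha> + 1)) - (LINT x|lebesgue_on \<Omega>. w x) powr (\<alpha> + 1))"

text \<open>The constant \<open>C\<^sub>B(p, 2)\<close>, whose value does not depend on \<open>p\<close>.\<close>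

definition beckner_C2 :: "real \<Rightarrow> real \<Rightarrow> real" where
  "beckner_C2 C\<^sub>P p = C\<^sub>P\<^sup>2"

text \<open>Only meant for \<open>0 < q < 2\<close>.\<close>

definition beckner_C' :: "real \<Rightarrow> real \<Rightarrow> real \<Rightarrow> real" where
  "beckner_C' C\<^sub>P p q =
     (if 1 \<le> q then q * (p * q - 1) * C\<^sub>P\<^sup>2 / (2 - q) else (p * q - 1) * C\<^sub>P\<^sup>2)"

text \<open>For \<open>t > 0\<close> the function \<open>u\<close> is smooth up to the boundary, i.e. smooth on an open
  neighbourhood of \<open>{0<..} \<times> closure \<Omega>\<close> (values away from this set are immaterial), and positive
  up to the boundary. Up to the initial time only continuity, and positivity in \<open>\<Omega>\<close>, are required;
  thus the initial datum may have infimum zero by vanishing on the boundary.\<close>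

definition smooth_positive_solution ::
    "'a::euclidean_space set \<Rightarrow> 'a measure \<Rightarrow> ('a \<Rightarrow> 'a) \<Rightarrow> real \<Rightarrow> ('a \<Rightarrow> real) \<Rightarrow>
     (real \<Rightarrow> 'a \<Rightarrow> real) \<Rightarrow> bool" where
  "smooth_positive_solution \<Omega> \<sigma> \<nu> \<beta> u\<^sub>0 u \<longleftrightarrow>
     (\<exists>W. open W \<and> {0<..} \<times> closure \<Omega> \<subseteq> W \<and> smooth_on W (\<lambda>(t, x). u t x)) \<and>
     continuous_on ({0..} \<times> closure \<Omega>) (\<lambda>(t, x). u t x) \<and>
     (\<forall>t>0. \<forall>x\<in>closure \<Omega>. u t x > 0) \<and>
     (\<forall>x\<in>\<Omega>. u 0 x > 0) \<and>
     (\<forall>t>0. \<forall>x\<in>\<Omega>. ((\<lambda>s. u s x) has_real_derivative laplacian (\<lambda>y. u t y powr \<beta>) x) (at t)) \<and>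
     (\<forall>t>0. AE x in \<sigma>. grad (\<lambda>y. u t y powr \<beta>) x \<bullet> \<nu> x = 0) \<and>
     (\<forall>x\<in>\<Omega>. u 0 x = u\<^sub>0 x)"

end

(* Mass is conserved, so by the divergence theorem the entropy E satisfies
   E' = - alpha beta int u^(alpha+beta-2) |grad u|^2.  The dissipation is bounded below by E in
   two ways.  Either u^(beta-1) is estimated by its infimum, which leaves |grad u^((alpha+1)/2)|^2,
   and Poincare-Wirtinger together with Jensen's inequality applies; or the dissipation is written
   as |grad u^p|^2 and Poincare-Wirtinger is combined with log-convexity of s |-> int f^s, which
   bounds the defect of the Beckner inequality by the variance of f = u^p.  In both cases
   Gronwall's lemma concludes. *)
theory Submission
  imports Defs
begin

text \<open>The obstacle is a mismatch of exponents. The dissipation controls the variance of v^p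
  with p = (\<alpha> + \<beta>)/2, while the entropy compares v^(\<alpha>+1) with the mass; 2p =
  \<alpha> + 1 only for \<beta> = 1. The first rate repairs this pointwise and so rests on the
  maximum principle. The second keeps f = v^p, for which f^q = v^(\<alpha>+1) and f^(1/p) = v. The
  factor (int f^q)^(2/q - 1) then makes both sides of the Beckner inequality homogeneous of degree 2
  in f. Jensen bounds it below by the power \<beta> - 1 of the mass, which is constant in time, so
  that the inequality becomes linear in the entropy and fit for Gronwall. The condition \<beta> > 1
  says exactly that q < 2. Differential inequalities are therefore derived for t > 0 only, and
  continuity of the integrals alone links them to the initial datum.\<close>

section \<open>Log-convexity of power integrals and the Beckner inequality\<close>

text \<open>Justifies taking logarithms of power integrals: a positive function with integral zero
  would vanish almost everywhere on a space of measure 1.\<close>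

lemma integral_powr_pos:
  assumes "finite_measure M" "measure M (space M) = 1"
    and "\<And>x. x \<in> space M \<Longrightarrow> f x > (0::real)" and "integrable M (\<lambda>x. f x powr s)"
  shows "(LINT x|M. f x powr s) > 0"
proof -
  interpret finite_measure M by fact
  have "(LINT x|M. f x powr s) \<noteq> 0"
  proof
    assume "(LINT x|M. f x powr s) = 0"
    then have "AE x in M. f x powr s = 0"
      by (subst (asm) integral_nonneg_eq_0_iff_AE) (use assms in auto)
    moreover have "AE x in M. f x powr s > 0"
      by (rule AE_I2) (use assms(3) in force)
    ultimately have "AE x in M. False" by eventually_elim auto
    then have "emeasure M (space M) = 0" by (simp add: AE_iff_measurable[OF _ refl])
    with assms(2) show False by (simp add: measure_def)
  qed
  moreover have "(LINT x|M. f x powr s) \<ge> 0" by simp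
  ultimately show ?thesis by linarith
qed

text \<open>This is Hoelder's inequality. Weighted Young is applied pointwise to f^a/A and f^b/B,
  which are normalised to have integral 1, so that the integrated right-hand side is l + (1 - l) =
  1.\<close>

lemma integral_powr_log_convex:
  assumes "finite_measure M" "measure M (space M) = 1"
    and pos: "\<And>x. x \<in> space M \<Longrightarrow> f x > (0::real)"
    and int: "\<And>s. integrable M (\<lambda>x. f x powr s)"
    and l: "0 \<le> l" "l \<le> 1"
  shows "ln (LINT x|M. f x powr (l * a + (1 - l) * b)) \<le>
    l * ln (LINT x|M. f x powr a) + (1 - l) * ln (LINT x|M. f x powr b)"
proof -
  define A B where "A = (LINT x|M. f x powr a)" and "B = (LINT x|M. f x powr b)"
  have A: "A > 0" and B: "B > 0"
    unfolding A_def B_def using assms by (auto intro!: integral_powr_pos)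
  have "(LINT x|M. f x powr (l * a + (1 - l) * b)) \<le>
      (LINT x|M. A powr l * B powr (1 - l) * (l / A * f x powr a + (1 - l) / B * f x powr b))"
  proof (rule integral_mono)
    fix x assume x: "x \<in> space M"
    have "(f x powr a / A) powr l * (f x powr b / B) powr (1 - l)
        \<le> l * (f x powr a / A) + (1 - l) * (f x powr b / B)"
      by (rule Youngs_inequality_0) (use l A B pos[OF x] in auto)
    then have "A powr l * B powr (1 - l) * ((f x powr a / A) powr l * (f x powr b / B) powr (1 - l))
        \<le> A powr l * B powr (1 - l) * (l * (f x powr a / A) + (1 - l) * (f x powr b / B))"
      by (rule mult_left_mono) simp
    moreover have "A powr l * B powr (1 - l) * ((f x powr a / A) powr l * (f x powr b / B) powr (1 - l))
        = f x powr (l * a + (1 - l) * b)"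
      using A B pos[OF x] by (simp add: powr_divide powr_powr powr_add mult.commute)
    ultimately show "f x powr (l * a + (1 - l) * b) \<le>
       A powr l * B powr (1 - l) * (l / A * f x powr a + (1 - l) / B * f x powr b)" by simp
  qed (use int in auto)
  also have "\<dots> = A powr l * B powr (1 - l)"
  proof -
    have "(LINT x|M. (l / A * f x powr a + (1 - l) / B * f x powr b)) = l / A * A + (1 - l) / B * B"
      using int by (subst Bochner_Integration.integral_add) (auto simp: A_def B_def)
    then show ?thesis using A B by simp
  qed
  finally have "ln (LINT x|M. f x powr (l * a + (1 - l) * b)) \<le> ln (A powr l * B powr (1 - l))"
    using integral_powr_pos[OF assms(1,2) pos int] A B by (subst ln_le_cancel_iff) auto
  also have "\<dots> = l * ln A + (1 - l) * ln B"
    using A B by (simp add: ln_mult_pos ln_powr)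
  finally show ?thesis by (simp add: A_def B_def)
qed

text \<open>The three-point form of log-convexity, cleared of denominators: the later estimates
  combine such inequalities linearly, and \<open>a = b\<close> needs no separate treatment
  there.\<close>

lemma integral_powr_interpolation:
  assumes "finite_measure M" "measure M (space M) = 1"
    and pos: "\<And>x. x \<in> space M \<Longrightarrow> f x > (0::real)"
    and int: "\<And>s. integrable M (\<lambda>x. f x powr s)"
    and "a \<le> c" "c \<le> b"
  shows "(b - a) * ln (LINT x|M. f x powr c) \<le>
    (b - c) * ln (LINT x|M. f x powr a) + (c - a) * ln (LINT x|M. f x powr b)"
proof (cases "a = b")
  case False
  then have ab: "a < b" using assms by auto
  define l where "l = (b - c) / (b - a)"
  have l: "0 \<le> l" "l \<le> 1" and l1: "(b - a) * l = b - c"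
    using ab assms(5,6) by (auto simp: l_def)
  have l2: "(b - a) * (1 - l) = c - a" using l1 by (simp add: algebra_simps)
  have "l * a + (1 - l) * b = c"
  proof -
    have "l * a + (1 - l) * b = b - (b - a) * l" by (simp add: algebra_simps)
    then show ?thesis using l1 by simp
  qed
  with integral_powr_log_convex[OF assms(1-4) l, of a b]
  have "(b - a) * ln (LINT x|M. f x powr c) \<le>
    (b - a) * (l * ln (LINT x|M. f x powr a) + (1 - l) * ln (LINT x|M. f x powr b))"
    using ab by (intro mult_left_mono) auto
  also have "\<dots> = (b - a) * l * ln (LINT x|M. f x powr a) +
      (b - a) * (1 - l) * ln (LINT x|M. f x powr b)"
    by (simp only: distrib_left mult.assoc)
  finally show ?thesis by (simp only: l1 l2)
qed (use assms in auto)

lemma ln_integral_powr_0: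
  assumes "measure M (space M) = 1" and "\<And>x. x \<in> space M \<Longrightarrow> f x > (0::real)"
  shows "ln (LINT x|M. f x powr 0) = 0"
proof -
  have "(LINT x|M. f x powr 0) = (LINT x|M. 1)"
    using assms(2) by (intro Bochner_Integration.integral_cong) (auto dest: less_imp_neq[OF assms(2)])
  then show ?thesis using assms by simp
qed

text \<open>The tangent of exp at y lies below its graph. This turns a difference of logarithms back
  into a difference of integrals.\<close>

lemma exp_mult_diff_le: "exp y * (z - y) \<le> exp z - exp (y::real)"
proof -
  have "exp y * (1 + (z - y)) \<le> exp y * exp (z - y)"
    by (intro mult_left_mono exp_ge_add_one_self) auto
  then show ?thesis by (simp add: algebra_simps flip: exp_add)
qed

text \<open>In the next two lemmas \<open>X\<close>, \<open>Y\<close>, \<open>Z\<close>, \<open>T\<close> are the logarithms of the integrals of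
  \<open>f\<^sup>q\<close>, \<open>f\<^sup>r\<close>, \<open>f\<^sup>2\<close>, \<open>f\<close>, with \<open>r = 1/p\<close>; the hypotheses are instances of log-convexity.\<close>

lemma beckner_exponents_ge_1:
  fixes q r X Y Z T :: real
  assumes "0 < r" "r < q" "q < 2"
    and XYZ: "(2 - r) * X \<le> (2 - q) * Y + (q - r) * Z" and TX: "q * T \<le> X"
  shows "exp X powr (2 / q - 1) * (exp X - exp Y powr (q / r)) \<le>
    q * (q / r - 1) / (2 - q) * (exp Z - exp (2 * T))"
proof -
  have q: "q > 0" using assms by auto
  \<comment> \<open>Both sides are invariant under scaling of f: adding s * c to the logarithm of
    each integral of f^s changes neither. The left side is the Beckner deficit on the logarithmic
    scale.\<close>
  have 0: "X - q * Y / r \<le> q * (q / r - 1) / (2 - q) * (Z - 2 * X / q)"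
  proof -
    have "q * ((2 - r) * X) \<le> q * ((2 - q) * Y + (q - r) * Z)"
      using XYZ q by simp
    then have "(2 - q) * (r * X - q * Y) \<le> (q - r) * (q * Z - 2 * X)"
      by (simp add: algebra_simps)
    then have "(2 - q) * (r * X - q * Y) / ((2 - q) * r) \<le> (q - r) * (q * Z - 2 * X) / ((2 - q) * r)"
      using assms by (intro divide_right_mono) auto
    moreover have "(2 - q) * (r * X - q * Y) / ((2 - q) * r) = X - q * Y / r"
      using assms by (simp add: diff_divide_distrib)
    moreover have "(q - r) * (q * Z - 2 * X) / ((2 - q) * r)
        = q * (q / r - 1) / (2 - q) * (Z - 2 * X / q)"
    proof -
      have "q * Z - 2 * X = q * (Z - 2 * X / q)" and "q - r = (q / r - 1) * r"
        using assms q by (simp_all add: right_diff_distrib left_diff_distrib)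
      then show ?thesis using assms by (simp add: mult_ac)
    qed
    ultimately show ?thesis by simp
  qed
  \<comment> \<open>Factoring out exp X leaves exp(2X/q), the squared L^q norm of f, times 1 -
    exp(-d) with d = X - qY/r; then 1 - exp(-d) \<le> d.\<close>
  have "exp X powr (2 / q - 1) * (exp X - exp Y powr (q / r))
      = exp (2 * X / q) * (1 - exp (q * Y / r - X))"
    by (simp add: powr_def right_diff_distrib left_diff_distrib algebra_simps flip: exp_add)
  also have "\<dots> \<le> exp (2 * X / q) * (X - q * Y / r)"
    using exp_ge_add_one_self[of "q * Y / r - X"] by (intro mult_left_mono exp_ge_zero) linarith
  also have "\<dots> \<le> exp (2 * X / q) * (q * (q / r - 1) / (2 - q) * (Z - 2 * X / q))"
    using 0 by (intro mult_left_mono) auto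
  also have "\<dots> = q * (q / r - 1) / (2 - q) * (exp (2 * X / q) * (Z - 2 * X / q))"
    by simp
  also have "\<dots> \<le> q * (q / r - 1) / (2 - q) * (exp Z - exp (2 * T))"
  proof (rule mult_left_mono)
    \<comment> \<open>Here \<open>q\<close> \<ge> 1 enters through the hypothesis on T: the L^q norm
      dominates the L^1 norm, so the squared L^q norm left by the tangent inequality may be lowered
      to the squared mean of f.\<close>
    have "2 * T \<le> 2 * X / q" using TX q by (simp add: field_simps)
    then show "exp (2 * X / q) * (Z - 2 * X / q) \<le> exp Z - exp (2 * T)"
      using exp_mult_diff_le[of "2 * X / q" Z] by (smt (verit) exp_le_cancel_iff)
  qed (use assms in \<open>auto simp: field_simps\<close>)
  finally show ?thesis .
qed

lemma beckner_exponents_less_1: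
  fixes q r X Y Z T :: real
  assumes "0 < r" "r < q" "q < 1"
    and XYT: "(1 - r) * X \<le> (1 - q) * Y + (q - r) * T"
    and TXZ: "(2 - q) * T \<le> X + (1 - q) * Z"
    and XT: "X \<le> q * T" and TZ: "2 * T \<le> Z"
  shows "exp X powr (2 / q - 1) * (exp X - exp Y powr (q / r)) \<le>
    (q / r - 1) * (exp Z - exp (2 * T))"
proof -
  have q: "q > 0" using assms by auto
  \<comment> \<open>For q < 1 the L^q norm lies below the L^1 norm, so the comparison with the
    squared mean used for q \<ge> 1 is lost. Interpolating q between r and 1 instead of between r
    and 2 brings in qT - X, which convexity on q, 1, 2 bounds by (1 - q)(Z - 2T).\<close>
  have 0: "X - q * Y / r \<le> (q / r - 1) * (Z - 2 * T)"
  proof -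
    have "q * ((1 - r) * X) \<le> q * ((1 - q) * Y + (q - r) * T)"
      using XYT q by simp
    then have "(1 - q) * (r * X - q * Y) \<le> (q - r) * (q * T - X)"
      by (simp add: algebra_simps)
    also have "\<dots> \<le> (q - r) * ((1 - q) * (Z - 2 * T))"
      using TXZ assms by (intro mult_left_mono) (auto simp: algebra_simps)
    finally have "(1 - q) * (r * X - q * Y) \<le> (1 - q) * ((q - r) * (Z - 2 * T))"
      by (simp add: mult_ac)
    then have "r * X - q * Y \<le> (q - r) * (Z - 2 * T)" using assms by simp
    then have "(r * X - q * Y) / r \<le> (q - r) * (Z - 2 * T) / r"
      using assms by (intro divide_right_mono) auto
    moreover have "(r * X - q * Y) / r = X - q * Y / r" and "(q - r) / r = q / r - 1"
      using assms by (simp_all add: diff_divide_distrib)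
    ultimately show ?thesis by (simp only: flip: times_divide_eq_left)
  qed
  have "exp X powr (2 / q - 1) * (exp X - exp Y powr (q / r))
      = exp (2 * X / q) * (1 - exp (q * Y / r - X))"
    by (simp add: powr_def right_diff_distrib left_diff_distrib algebra_simps flip: exp_add)
  also have "\<dots> \<le> exp (2 * X / q) * (X - q * Y / r)"
    using exp_ge_add_one_self[of "q * Y / r - X"] by (intro mult_left_mono exp_ge_zero) linarith
  also have "\<dots> \<le> exp (2 * X / q) * ((q / r - 1) * (Z - 2 * T))"
    using 0 by (intro mult_left_mono) auto
  \<comment> \<open>The squared L^q norm is raised to the squared mean; this is allowed because the
    other factor is nonnegative by 2T \<le> Z.\<close>
  also have "\<dots> \<le> exp (2 * T) * ((q / r - 1) * (Z - 2 * T))"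
    using XT TZ assms q by (intro mult_right_mono mult_nonneg_nonneg) (auto simp: field_simps)
  also have "\<dots> = (q / r - 1) * (exp (2 * T) * (Z - 2 * T))" by simp
  also have "\<dots> \<le> (q / r - 1) * (exp Z - exp (2 * T))"
    using exp_mult_diff_le[of "2 * T" Z] assms by (intro mult_left_mono) (auto simp: field_simps)
  finally show ?thesis .
qed

section \<open>Jensen's inequality for powers and the Beckner inequality with the variance as
  bound\<close>

lemma integral_powr_le_powr_integral:
  assumes M: "finite_measure M" "measure M (space M) = 1"
    and pos: "\<And>x. x \<in> space M \<Longrightarrow> f x > (0::real)"
    and int: "\<And>s. integrable M (\<lambda>x. f x powr s)"
    and s: "0 \<le> s" "s \<le> 1"
  shows "(LINT x|M. f x powr s) \<le> (LINT x|M. f x powr 1) powr s"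
proof -
  note P = integral_powr_pos[OF M pos int]
  define A where "A s = (LINT x|M. f x powr s)" for s
  \<comment> \<open>Convexity of s |-> ln (A s) between 0 and 1, where it vanishes at 0 because the
    space has measure 1.\<close>
  have "ln (A s) \<le> s * ln (A 1)"
    unfolding A_def using integral_powr_interpolation[OF M pos int s] ln_integral_powr_0[OF M(2) pos] by simp
  then have "exp (ln (A s)) \<le> exp (s * ln (A 1))" by simp
  then have "A s \<le> A 1 powr s"
    using P[of s, folded A_def] P[of 1, folded A_def] by (simp add: powr_def)
  then show ?thesis by (simp only: A_def)
qed

lemma powr_integral_le_integral_powr:
  assumes M: "finite_measure M" "measure M (space M) = 1"
    and pos: "\<And>x. x \<in> space M \<Longrightarrow> f x > (0::real)"
    and int: "\<And>s. integrable M (\<lambda>x. f x powr s)"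
    and s: "1 \<le> s"
  shows "(LINT x|M. f x powr 1) powr s \<le> (LINT x|M. f x powr s)"
proof -
  note P = integral_powr_pos[OF M pos int]
  define A where "A s = (LINT x|M. f x powr s)" for s
  have "s * ln (A 1) \<le> ln (A s)"
    unfolding A_def using integral_powr_interpolation[OF M pos int, of 0 1 s] ln_integral_powr_0[OF M(2) pos] s by simp
  then have "exp (s * ln (A 1)) \<le> exp (ln (A s))" by simp
  then have "A 1 powr s \<le> A s"
    using P[of s, folded A_def] P[of 1, folded A_def] by (simp add: powr_def)
  then show ?thesis by (simp only: A_def)
qed

text \<open>The purely measure-theoretic half of the Beckner inequality;
  \<open>beckner_C' 1 p q\<close> is the constant stripped of the factor C_P^2 that
  Poincare-Wirtinger supplies later. The two branches of that constant come from two different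
  choices of interpolation points.\<close>

lemma beckner_variance:
  assumes M: "finite_measure M" "measure M (space M) = 1"
    and pos: "\<And>x. x \<in> space M \<Longrightarrow> f x > (0::real)"
    and int: "\<And>s. integrable M (\<lambda>x. f x powr s)"
    and pq: "0 < p" "1 < p * q" "q < 2"
  shows "(LINT x|M. f x powr q) powr (2 / q - 1) *
      ((LINT x|M. f x powr q) - (LINT x|M. f x powr (1 / p)) powr (p * q)) \<le>
    beckner_C' 1 p q * ((LINT x|M. f x powr 2) - (LINT x|M. f x powr 1)\<^sup>2)"
proof -
  note P = integral_powr_pos[OF M pos int]
  define L where "L s = ln (LINT x|M. f x powr s)" for s
  have N: "(LINT x|M. f x powr s) = exp (L s)" for s using P[of s] by (simp add: L_def)
  have conv: "(b - a) * L c \<le> (b - c) * L a + (c - a) * L b" if "a \<le> c" "c \<le> b" for a b c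
    unfolding L_def using integral_powr_interpolation[OF M pos int that] by simp
  have L0: "L 0 = 0" unfolding L_def using ln_integral_powr_0[OF M(2) pos] by simp
  have r: "0 < 1 / p" "1 / p < q" using pq by (auto simp: field_simps)
  have sq: "(exp (L 1))\<^sup>2 = exp (2 * L 1)" by (simp add: exp_double)
  have "exp (L q) powr (2 / q - 1) * (exp (L q) - exp (L (1 / p)) powr (p * q)) \<le>
      beckner_C' 1 p q * (exp (L 2) - exp (2 * L 1))"
  proof (cases "1 \<le> q")
    case True
    have "(2 - 1 / p) * L q \<le> (2 - q) * L (1 / p) + (q - 1 / p) * L 2"
      using r pq by (intro conv) auto
    moreover have "q * L 1 \<le> L q" using conv[of 0 1 q] True L0 by simp
    ultimately show ?thesis using beckner_exponents_ge_1[OF r pq(3), of "L q" "L (1 / p)" "L 2" "L 1"] True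
      by (simp add: beckner_C'_def mult_ac)
  next
    case False
    then have q: "q < 1" by simp
    have "(1 - 1 / p) * L q \<le> (1 - q) * L (1 / p) + (q - 1 / p) * L 1"
      using r q by (intro conv) auto
    moreover have "(2 - q) * L 1 \<le> L q + (1 - q) * L 2" using conv[of q 1 2] q by simp
    moreover have "L q \<le> q * L 1" using conv[of 0 q 1] q r L0 by simp
    moreover have "2 * L 1 \<le> L 2" using conv[of 0 1 2] L0 by simp
    ultimately show ?thesis using beckner_exponents_less_1[OF r q, of "L q" "L (1 / p)" "L 1" "L 2"] False
      by (simp add: beckner_C'_def mult_ac)
  qed
  then show ?thesis unfolding N sq .
qed

section \<open>Continuously differentiable functions\<close>

lemma Ck_on_1: "Ck_on 1 S f \<longleftrightarrow> (\<forall>x\<in>S. f differentiable (at x)) \<and>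
     (\<forall>b\<in>Basis. continuous_on S (\<lambda>x. frechet_derivative f (at x) b))"
  by (simp add: One_nat_def)

lemma Ck_on_1_continuous: "Ck_on 1 S f \<Longrightarrow> continuous_on S f"
  unfolding Ck_on_1
  by (meson continuous_at_imp_continuous_on differentiable_imp_continuous_within)

lemma Ck_on_1I:
  assumes "\<And>x. x \<in> S \<Longrightarrow> (f has_derivative f' x) (at x)"
    and "\<And>b. b \<in> Basis \<Longrightarrow> continuous_on S (\<lambda>x. f' x b)"
  shows "Ck_on 1 S f"
proof -
  have "continuous_on S (\<lambda>x. frechet_derivative f (at x) b)" if "b \<in> Basis" for b
    using assms(2)[OF that]
    by (rule continuous_on_eq) (use frechet_derivative_at[OF assms(1)] in metis)
  then show ?thesis using assms(1) unfolding Ck_on_1 differentiable_def by blast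
qed

lemma Ck_on_1_has_derivative:
  "Ck_on 1 S f \<Longrightarrow> x \<in> S \<Longrightarrow> (f has_derivative frechet_derivative f (at x)) (at x)"
  unfolding Ck_on_1 using frechet_derivative_works by blast

text \<open>On an open set the derivative at a point depends only on the values in the set, so the
  equality passes to all partial derivatives and the induction goes through.\<close>

lemma Ck_on_cong:
  assumes "open S" "Ck_on k S f" "\<And>x. x \<in> S \<Longrightarrow> f x = g x"
  shows "Ck_on k S g"
  using assms(2,3)
proof (induction k arbitrary: f g)
  case 0
  then show ?case by (simp cong: continuous_on_cong)
next
  case (Suc k)
  have d: "(g has_derivative frechet_derivative f (at x)) (at x)" if "x \<in> S" for x
  proof (rule has_derivative_transform_within_open[OF _ assms(1) that])
    show "(f has_derivative frechet_derivative f (at x)) (at x)"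
      using Suc.prems(1) that frechet_derivative_works by auto
  qed (rule Suc.prems(2))
  have "Ck_on k S (\<lambda>x. frechet_derivative g (at x) b)" if "b \<in> Basis" for b
  proof (rule Suc.IH)
    show "Ck_on k S (\<lambda>x. frechet_derivative f (at x) b)" using Suc.prems(1) that by simp
    show "frechet_derivative f (at x) b = frechet_derivative g (at x) b" if "x \<in> S" for x
      using frechet_derivative_at[OF d[OF that]] by simp
  qed
  then show ?case using d unfolding Ck_on.simps differentiable_def by blast
qed

lemma Ck_on_subset: "Ck_on k S f \<Longrightarrow> T \<subseteq> S \<Longrightarrow> Ck_on k T f"
  by (induction k arbitrary: f) (auto intro: continuous_on_subset)

lemma Ck_on_1_scaleR:
  fixes f :: "'a::euclidean_space \<Rightarrow> real"
  assumes "Ck_on 1 S f" "Ck_on 1 S g"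
  shows "Ck_on 1 S (\<lambda>x. f x *\<^sub>R g x)"
proof (rule Ck_on_1I)
  show "((\<lambda>x. f x *\<^sub>R g x) has_derivative
      (\<lambda>h. f x *\<^sub>R frechet_derivative g (at x) h + frechet_derivative f (at x) h *\<^sub>R g x)) (at x)"
    if "x \<in> S" for x
    using Ck_on_1_has_derivative[OF assms(1) that] Ck_on_1_has_derivative[OF assms(2) that]
    by (rule has_derivative_scaleR)
  show "continuous_on S
      (\<lambda>x. f x *\<^sub>R frechet_derivative g (at x) b + frechet_derivative f (at x) b *\<^sub>R g x)"
    if "b \<in> Basis" for b
    using that assms Ck_on_1_continuous[OF assms(1)] Ck_on_1_continuous[OF assms(2)]
    unfolding Ck_on_1 by (intro continuous_intros) auto
qed

lemma Ck_on_1_const: "Ck_on 1 S (\<lambda>x. c)"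
  by (rule Ck_on_1I[where f' = "\<lambda>x h. 0"]) auto

lemma has_derivative_powr_const:
  fixes v :: "'a::real_normed_vector \<Rightarrow> real"
  assumes "(v has_derivative v') (at x)" "v x > 0"
  shows "((\<lambda>y. v y powr s) has_derivative (\<lambda>h. (s * v x powr (s - 1)) *\<^sub>R v' h)) (at x)"
  using has_derivative_powr[OF assms(1) has_derivative_const[of s] assms(2)] assms(2)
  by (simp add: powr_diff mult_ac)

lemma Ck_on_1_powr:
  assumes "Ck_on 1 S v" "\<And>x. x \<in> S \<Longrightarrow> v x > (0::real)"
  shows "Ck_on 1 S (\<lambda>x. v x powr s)"
proof (rule Ck_on_1I)
  show "((\<lambda>x. v x powr s) has_derivative
      (\<lambda>h. (s * v x powr (s - 1)) *\<^sub>R frechet_derivative v (at x) h)) (at x)" if "x \<in> S" for x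
    using Ck_on_1_has_derivative[OF assms(1) that] assms(2)[OF that]
    by (rule has_derivative_powr_const)
  show "continuous_on S (\<lambda>x. (s * v x powr (s - 1)) *\<^sub>R frechet_derivative v (at x) b)"
    if "b \<in> Basis" for b
    using that assms Ck_on_1_continuous[OF assms(1)]
    unfolding Ck_on_1 by (intro continuous_intros) (auto dest: less_imp_neq[OF assms(2)])
qed

lemma Ck_on_1_sum:
  assumes "finite I" "\<And>i. i \<in> I \<Longrightarrow> Ck_on 1 S (f i)"
  shows "Ck_on 1 S (\<lambda>x. \<Sum>i\<in>I. f i x)"
proof (rule Ck_on_1I)
  show "((\<lambda>x. \<Sum>i\<in>I. f i x) has_derivative (\<lambda>h. \<Sum>i\<in>I. frechet_derivative (f i) (at x) h)) (at x)"
    if "x \<in> S" for x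
    using Ck_on_1_has_derivative[OF assms(2) that] by (rule has_derivative_sum)
  show "continuous_on S (\<lambda>x. \<Sum>i\<in>I. frechet_derivative (f i) (at x) b)" if "b \<in> Basis" for b
    using that assms unfolding Ck_on_1 by (intro continuous_intros) auto
qed

lemma Ck_on_2_grad:
  assumes "Ck_on 2 S v"
  shows "Ck_on 1 S v" "Ck_on 1 S (grad v)"
proof -
  \<comment> \<open>\<open>Ck_on (Suc k)\<close> asks only differentiability of the function itself;
    continuity of the first derivatives has to be recovered from their being once
    differentiable.\<close>
  have 2: "Ck_on (Suc 1) S v" using assms by (simp add: numeral_2_eq_2)
  then have *: "Ck_on 1 S (\<lambda>x. frechet_derivative v (at x) b)" if "b \<in> Basis" for b
    using that by (simp only: Ck_on.simps)
  have "continuous_on S (\<lambda>x. frechet_derivative v (at x) b)" if "b \<in> Basis" for b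
    using *[OF that] by (rule Ck_on_1_continuous)
  then show "Ck_on 1 S v" using 2 unfolding Ck_on_1 Ck_on.simps(2) by blast
  show "Ck_on 1 S (grad v)"
    unfolding grad_def[abs_def]
    by (intro Ck_on_1_sum Ck_on_1_scaleR Ck_on_1_const * finite_Basis)
qed

section \<open>Calculus rules for gradient and divergence\<close>

lemma grad_eq:
  assumes "(f has_derivative f') (at x)"
  shows "grad f x = (\<Sum>b\<in>Basis. f' b *\<^sub>R b)"
  unfolding grad_def using frechet_derivative_at[OF assms] by simp

lemma grad_inner_Basis: "b \<in> Basis \<Longrightarrow> grad f x \<bullet> b = frechet_derivative f (at x) b"
  by (simp add: grad_def inner_sum_left_Basis)

lemma divergence_eq:
  assumes "(F has_derivative F') (at x)"
  shows "divergence F x = (\<Sum>b\<in>Basis. F' b \<bullet> b)"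
  unfolding divergence_def using frechet_derivative_at[OF assms] by simp

lemma grad_powr:
  assumes "v differentiable (at x)" "v x > 0"
  shows "grad (\<lambda>y. v y powr s) x = (s * v x powr (s - 1)) *\<^sub>R grad v x"
proof -
  have "(v has_derivative frechet_derivative v (at x)) (at x)"
    using assms(1) by (simp add: frechet_derivative_works)
  from grad_eq[OF has_derivative_powr_const[OF this assms(2)]] show ?thesis
    by (simp add: grad_def scaleR_sum_right)
qed

lemma divergence_scaleR:
  fixes f :: "'a::euclidean_space \<Rightarrow> real"
  assumes "f differentiable (at x)" "F differentiable (at x)"
  shows "divergence (\<lambda>y. f y *\<^sub>R F y) x = grad f x \<bullet> F x + f x * divergence F x"
proof -
  have "((\<lambda>y. f y *\<^sub>R F y) has_derivative
      (\<lambda>h. f x *\<^sub>R frechet_derivative F (at x) h + frechet_derivative f (at x) h *\<^sub>R F x)) (at x)"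
    using assms unfolding frechet_derivative_works by (rule has_derivative_scaleR)
  from divergence_eq[OF this] show ?thesis
    by (simp add: inner_add_left sum.distrib divergence_def grad_def inner_sum_left
        sum_distrib_left inner_commute[of "F x"] add.commute)
qed

lemma divergence_cong:
  assumes "F differentiable (at x)" "open S" "x \<in> S" "\<And>y. y \<in> S \<Longrightarrow> F y = G y"
  shows "divergence F x = divergence G x"
  unfolding divergence_def using frechet_derivative_transform_within_open[OF assms] by simp

lemma continuous_on_divergence: "Ck_on 1 S F \<Longrightarrow> continuous_on S (divergence F)"
  unfolding divergence_def[abs_def] Ck_on_1 by (intro continuous_intros) auto

lemma continuous_on_grad: "Ck_on 1 S f \<Longrightarrow> continuous_on S (grad f)"
  unfolding grad_def[abs_def] Ck_on_1 by (intro continuous_intros) auto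

section \<open>Integration by parts\<close>

text \<open>Continuity up to the closure matters: compactness of the closure bounds f, and a bounded
  measurable function is integrable on a set of finite measure.\<close>

lemma integrable_lebesgue_on_continuous:
  fixes f :: "'a::euclidean_space \<Rightarrow> 'b::euclidean_space"
  assumes "open S" "bounded S" "continuous_on (closure S) f"
  shows "integrable (lebesgue_on S) f"
proof -
  have S: "S \<in> lmeasurable" using assms by (simp add: bounded_set_imp_lmeasurable)
  interpret finite_measure "lebesgue_on S"
    using S by (simp add: finite_measure_lebesgue_on)
  have "compact (f ` closure S)"
    using assms by (intro compact_continuous_image) (auto simp: compact_closure)
  then obtain B where B: "\<And>x. x \<in> closure S \<Longrightarrow> norm (f x) \<le> B"
    by (metis bounded_iff compact_imp_bounded imageI)
  show ?thesis
  proof (rule integrable_const_bound)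
    show "AE x in lebesgue_on S. norm (f x) \<le> B"
      using B closure_subset by (intro AE_I2) (auto simp: space_restrict_space)
    show "f \<in> borel_measurable (lebesgue_on S)"
      using assms(3) closure_subset S
      by (intro continuous_imp_measurable_on_sets_lebesgue) (auto intro: continuous_on_subset)
  qed
qed

lemma L2_on_continuous:
  fixes f :: "'a::euclidean_space \<Rightarrow> 'b::euclidean_space"
  assumes "open S" "bounded S" "continuous_on (closure S) f"
  shows "L2_on S f"
proof -
  have "continuous_on (closure S) (\<lambda>x. (norm (f x))\<^sup>2)"
    using assms(3) by (intro continuous_on_power continuous_on_norm)
  then show ?thesis
    unfolding L2_on_def
    using integrable_lebesgue_on_continuous[OF assms]
      integrable_lebesgue_on_continuous[OF assms(1,2), of "\<lambda>x. (norm (f x))\<^sup>2"] by simp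
qed

section \<open>The divergence theorem with vanishing flux and its consequences\<close>

lemma unit_exterior_normal_frontier:
  assumes "unit_exterior_normal \<Omega> \<sigma> \<nu>"
  shows "AE x in \<sigma>. x \<in> frontier \<Omega>"
proof -
  have "AE x in \<sigma>. x \<in> frontier \<Omega> \<and> exterior_normal_at \<Omega> x (\<nu> x)"
    using assms unfolding unit_exterior_normal_def by (elim conjE)
  then show ?thesis by eventually_elim (rule conjunct1)
qed

lemma integral_divergence_eq_0:
  assumes "unit_exterior_normal \<Omega> \<sigma> \<nu>" "open V" "closure \<Omega> \<subseteq> V" "Ck_on 1 V F"
    and "AE x in \<sigma>. F x \<bullet> \<nu> x = 0"
  shows "(LINT x|lebesgue_on \<Omega>. divergence F x) = 0"
proof -
  have "(LINT x|lebesgue_on \<Omega>. divergence F x) = (LINT x|\<sigma>. F x \<bullet> \<nu> x)"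
    using assms(1)[unfolded unit_exterior_normal_def, THEN conjunct2, THEN conjunct2,
        THEN conjunct2, THEN conjunct2, rule_format, of V F] assms(2-4) by simp
  also have "\<dots> = 0" using assms(5) by (rule integral_eq_zero_AE)
  finally show ?thesis .
qed

lemma energy_identity:
  assumes \<Omega>: "open \<Omega>" "bounded \<Omega>" and n: "unit_exterior_normal \<Omega> \<sigma> \<nu>"
    and V: "open V" "closure \<Omega> \<subseteq> V" and v: "Ck_on 2 V v" "\<And>x. x \<in> V \<Longrightarrow> v x > 0"
    and bc: "AE x in \<sigma>. grad (\<lambda>y. v y powr \<beta>) x \<bullet> \<nu> x = 0"
  shows "(LINT x|lebesgue_on \<Omega>. v x powr \<alpha> * laplacian (\<lambda>y. v y powr \<beta>) x) =
    - (\<alpha> * \<beta> * (LINT x|lebesgue_on \<Omega>. v x powr (\<alpha> + \<beta> - 2) * (norm (grad v x))\<^sup>2))"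
proof -
  note v1 = Ck_on_2_grad[OF v(1)]
  have diff: "v differentiable (at x)" if "x \<in> V" for x using v1(1) that unfolding Ck_on_1 by blast
  define H where "H x = (\<beta> * v x powr (\<beta> - 1)) *\<^sub>R grad v x" for x
  define D where "D x = \<alpha> * \<beta> * (v x powr (\<alpha> + \<beta> - 2) * (norm (grad v x))\<^sup>2)" for x
  define P where "P x = v x powr \<alpha> * divergence H x" for x
  have vp: "Ck_on 1 V (\<lambda>x. v x powr s)" for s using v1(1) v(2) by (rule Ck_on_1_powr)
  have H1: "Ck_on 1 V H"
  proof -
    have "Ck_on 1 V (\<lambda>x. \<beta> *\<^sub>R (v x powr (\<beta> - 1) *\<^sub>R grad v x))"
      by (intro Ck_on_1_scaleR Ck_on_1_const vp v1(2))
    then show ?thesis by (simp add: H_def[abs_def])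
  qed
  have grad: "grad (\<lambda>y. v y powr \<beta>) x = H x" if "x \<in> V" for x
    unfolding H_def using grad_powr[OF diff v(2)] that by blast
  \<comment> \<open>The formula \<open>H\<close> for the gradient holds only where v is positive, so
    the divergences are compared through equality on the open set \<open>V\<close>.\<close>
  have lap: "laplacian (\<lambda>y. v y powr \<beta>) x = divergence H x" if "x \<in> V" for x
    unfolding laplacian_def
    by (rule divergence_cong[OF _ V(1) that, symmetric])
      (use H1 that grad in \<open>auto simp: Ck_on_1\<close>)
  have F1: "Ck_on 1 V (\<lambda>x. v x powr \<alpha> *\<^sub>R H x)" by (intro Ck_on_1_scaleR vp H1)
  have div: "divergence (\<lambda>x. v x powr \<alpha> *\<^sub>R H x) x = D x + P x" if x: "x \<in> V" for x
  proof -
    have d: "(\<lambda>x. v x powr \<alpha>) differentiable (at x)" "H differentiable (at x)"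
      using vp H1 x unfolding Ck_on_1 by blast+
    have "v x powr (\<alpha> - 1) * v x powr (\<beta> - 1) = v x powr (\<alpha> + \<beta> - 2)"
      using v(2)[OF x] by (simp flip: powr_add)
    then have "grad (\<lambda>x. v x powr \<alpha>) x \<bullet> H x = D x"
      by (simp add: grad_powr[OF diff[OF x] v(2)[OF x]] H_def D_def power2_norm_eq_inner mult_ac)
    then show ?thesis using divergence_scaleR[OF d] by (simp add: P_def)
  qed
  have sub: "\<Omega> \<subseteq> V" using V closure_subset by blast
  have vc: "continuous_on (closure \<Omega>) (\<lambda>x. v x powr s)" for s
    using Ck_on_1_continuous[OF vp] V(2) by (rule continuous_on_subset)
  have iD: "integrable (lebesgue_on \<Omega>) D"
    unfolding D_def using continuous_on_subset[OF continuous_on_grad[OF v1(1)] V(2)] vc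
    by (intro integrable_lebesgue_on_continuous[OF \<Omega>] continuous_on_mult continuous_on_power
        continuous_on_norm continuous_on_const) auto
  have iP: "integrable (lebesgue_on \<Omega>) P"
    unfolding P_def using continuous_on_subset[OF continuous_on_divergence[OF H1] V(2)] vc
    by (intro integrable_lebesgue_on_continuous[OF \<Omega>] continuous_on_mult continuous_on_power
        continuous_on_norm continuous_on_const) auto
  have "(LINT x|lebesgue_on \<Omega>. D x) + (LINT x|lebesgue_on \<Omega>. P x) =
      (LINT x|lebesgue_on \<Omega>. divergence (\<lambda>x. v x powr \<alpha> *\<^sub>R H x) x)"
    unfolding Bochner_Integration.integral_add[OF iD iP, symmetric]
    using div sub by (intro Bochner_Integration.integral_cong) auto
  also have "\<dots> = 0"
  proof (rule integral_divergence_eq_0[OF n V F1])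
    show "AE x in \<sigma>. (v x powr \<alpha> *\<^sub>R H x) \<bullet> \<nu> x = 0"
      using bc unit_exterior_normal_frontier[OF n]
    proof eventually_elim
      case (elim x)
      then have "x \<in> V" using V(2) by (auto simp: frontier_def)
      then show ?case using elim grad by simp
    qed
  qed
  finally have "(LINT x|lebesgue_on \<Omega>. P x) = - (LINT x|lebesgue_on \<Omega>. D x)" by simp
  moreover have "(LINT x|lebesgue_on \<Omega>. v x powr \<alpha> * laplacian (\<lambda>y. v y powr \<beta>) x) =
      (LINT x|lebesgue_on \<Omega>. P x)"
    using lap sub by (intro Bochner_Integration.integral_cong) (auto simp: P_def)
  ultimately show ?thesis by (simp add: D_def)
qed

lemma test_function_Ck_on_1: "test_function \<Omega> \<phi> \<Longrightarrow> Ck_on 1 UNIV \<phi>"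
  unfolding test_function_def smooth_on_def by blast

lemma test_function_eq_0:
  assumes "test_function \<Omega> \<phi>" "x \<notin> \<Omega>"
  shows "\<phi> x = 0"
  using assms closure_subset[of "{x. \<phi> x \<noteq> 0}"] unfolding test_function_def by blast

text \<open>Poincare-Wirtinger is assumed for weak gradients, so a classical gradient must be
  recognised as one. The divergence theorem for f \<phi> b gives the integration by parts.\<close>

lemma H1_with_gradient_Ck_on_1:
  assumes \<Omega>: "open \<Omega>" "bounded \<Omega>" and n: "unit_exterior_normal \<Omega> \<sigma> \<nu>"
    and V: "open V" "closure \<Omega> \<subseteq> V" and f: "Ck_on 1 V f"
  shows "H1_with_gradient \<Omega> f (grad f)"
proof -
  have sub: "\<Omega> \<subseteq> V" using V closure_subset by blast
  have fc: "continuous_on (closure \<Omega>) f" and gc: "continuous_on (closure \<Omega>) (grad f)"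
    using continuous_on_subset[OF _ V(2)] Ck_on_1_continuous[OF f] continuous_on_grad[OF f]
    by blast+
  have "L2_on \<Omega> f" "L2_on \<Omega> (grad f)"
    using fc gc by (simp_all add: L2_on_continuous[OF \<Omega>])
  moreover have "weak_gradient \<Omega> f (grad f)"
    unfolding weak_gradient_def
  proof (intro allI impI ballI)
    fix \<phi> :: "'a \<Rightarrow> real" and b :: 'a assume \<phi>: "test_function \<Omega> \<phi>" and b: "b \<in> Basis"
    have \<phi>1: "Ck_on 1 V \<phi>" using test_function_Ck_on_1[OF \<phi>] by (rule Ck_on_subset) simp
    have dphi: "\<phi> differentiable (at x)" if "x \<in> V" for x using \<phi>1 that unfolding Ck_on_1 by blast
    have df: "f differentiable (at x)" if "x \<in> V" for x using f that unfolding Ck_on_1 by blast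
    have dphib: "(\<lambda>x. \<phi> x *\<^sub>R b) differentiable (at x)" if "x \<in> V" for x
      using Ck_on_1_scaleR[OF \<phi>1 Ck_on_1_const] that unfolding Ck_on_1 by blast
    have F1: "Ck_on 1 V (\<lambda>x. f x *\<^sub>R (\<phi> x *\<^sub>R b))"
      by (intro Ck_on_1_scaleR f \<phi>1 Ck_on_1_const)
    have b0: "divergence (\<lambda>x. b) x = 0" for x
      using divergence_eq[OF has_derivative_const, of b x] by simp
    have div: "divergence (\<lambda>x. f x *\<^sub>R (\<phi> x *\<^sub>R b)) x =
        (grad f x \<bullet> b) * \<phi> x + f x * frechet_derivative \<phi> (at x) b" if x: "x \<in> V" for x
      by (simp add: divergence_scaleR[OF df[OF x] dphib[OF x]] divergence_scaleR[OF dphi[OF x]]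
          b0 grad_inner_Basis[OF b] mult.commute del: scaleR_scaleR)
    have "continuous_on V (\<lambda>x. frechet_derivative \<phi> (at x) b)"
      using \<phi>1 b by (simp add: Ck_on_1)
    then have phic: "continuous_on (closure \<Omega>) \<phi>"
       "continuous_on (closure \<Omega>) (\<lambda>x. frechet_derivative \<phi> (at x) b)"
      using continuous_on_subset[OF _ V(2)] Ck_on_1_continuous[OF \<phi>1] by blast+
    have i1: "integrable (lebesgue_on \<Omega>) (\<lambda>x. (grad f x \<bullet> b) * \<phi> x)"
      and i2: "integrable (lebesgue_on \<Omega>) (\<lambda>x. f x * frechet_derivative \<phi> (at x) b)"
      using fc gc phic
      by (simp_all add: integrable_lebesgue_on_continuous[OF \<Omega>] continuous_on_mult
          continuous_on_inner)
    have "(LINT x|lebesgue_on \<Omega>. (grad f x \<bullet> b) * \<phi> x) +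
        (LINT x|lebesgue_on \<Omega>. f x * frechet_derivative \<phi> (at x) b) =
        (LINT x|lebesgue_on \<Omega>. divergence (\<lambda>x. f x *\<^sub>R (\<phi> x *\<^sub>R b)) x)"
      unfolding Bochner_Integration.integral_add[OF i1 i2, symmetric]
      using div sub by (intro Bochner_Integration.integral_cong) auto
    also have "\<dots> = 0"
    proof (rule integral_divergence_eq_0[OF n V F1])
      show "AE x in \<sigma>. (f x *\<^sub>R (\<phi> x *\<^sub>R b)) \<bullet> \<nu> x = 0"
        using unit_exterior_normal_frontier[OF n]
      proof eventually_elim
        case (elim x)
        \<comment> \<open>An open set misses its frontier, and a test function vanishes off the
          domain: the boundary flux is zero for any normal field.\<close>
        then have "x \<notin> \<Omega>" using \<Omega>(1) by (simp add: frontier_def interior_open)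
        then show ?case using test_function_eq_0[OF \<phi>] by simp
      qed
    qed
    finally show "(LINT x|lebesgue_on \<Omega>. f x * frechet_derivative \<phi> (at x) b) =
      - (LINT x|lebesgue_on \<Omega>. (grad f x \<bullet> b) * \<phi> x)" by simp
  qed
  ultimately show ?thesis unfolding H1_with_gradient_def by blast
qed

section \<open>Parameter integrals\<close>

text \<open>In a first-countable space limits can be tested along sequences, where dominated
  convergence with a constant majorant applies.\<close>

lemma tendsto_integral_bounded:
  fixes f :: "'b::first_countable_topology \<Rightarrow> 'a \<Rightarrow> real"
  assumes "finite_measure M"
    and "\<And>s. s \<in> S \<Longrightarrow> f s \<in> borel_measurable M" and "g \<in> borel_measurable M"
    and "\<And>s x. s \<in> S \<Longrightarrow> x \<in> space M \<Longrightarrow> \<bar>f s x\<bar> \<le> B"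
    and "\<And>x. x \<in> space M \<Longrightarrow> ((\<lambda>s. f s x) \<longlongrightarrow> g x) (at t within S)"
  shows "((\<lambda>s. LINT x|M. f s x) \<longlongrightarrow> (LINT x|M. g x)) (at t within S)"
  unfolding tendsto_at_iff_sequentially comp_def
proof (intro allI impI)
  interpret finite_measure M by fact
  fix X assume X: "\<forall>i. X i \<in> S - {t}" "X \<longlonglongrightarrow> t"
  show "(\<lambda>i. LINT x|M. f (X i) x) \<longlonglongrightarrow> (LINT x|M. g x)"
  proof (rule integral_dominated_convergence[where w = "\<lambda>x. B"])
    show "AE x in M. (\<lambda>i. f (X i) x) \<longlonglongrightarrow> g x"
      using assms(5) X unfolding tendsto_at_iff_sequentially comp_def by (intro AE_I2) blast
    show "AE x in M. norm (f (X i) x) \<le> B" for i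
      using assms(4) X by (intro AE_I2) (simp add: Ball_def)
    show "f (X i) \<in> borel_measurable M" for i using assms(2) X by blast
  qed (simp_all add: assms(3))
qed

lemma continuous_on_integral_bounded:
  fixes f :: "'b::first_countable_topology \<Rightarrow> 'a \<Rightarrow> real"
  assumes "finite_measure M" "\<And>s. s \<in> S \<Longrightarrow> f s \<in> borel_measurable M"
    and "\<And>s x. s \<in> S \<Longrightarrow> x \<in> space M \<Longrightarrow> \<bar>f s x\<bar> \<le> B"
    and "\<And>x. x \<in> space M \<Longrightarrow> continuous_on S (\<lambda>s. f s x)"
  shows "continuous_on S (\<lambda>s. LINT x|M. f s x)"
  unfolding continuous_on_def
proof
  fix t assume "t \<in> S"
  show "((\<lambda>s. LINT x|M. f s x) \<longlongrightarrow> (LINT x|M. f t x)) (at t within S)"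
  proof (rule tendsto_integral_bounded[OF assms(1-2) _ assms(3)])
    show "((\<lambda>s. f s x) \<longlongrightarrow> f t x) (at t within S)" if "x \<in> space M" for x
      using assms(4)[OF that] \<open>t \<in> S\<close> unfolding continuous_on_def by blast
  qed (use \<open>t \<in> S\<close> assms(2) in blast)+
qed

text \<open>The mean value inequality on the interval bounds all difference quotients by
  \<open>B\<close>, so the limit may be taken under the integral by bounded convergence.\<close>

lemma has_real_derivative_integral:
  fixes g :: "real \<Rightarrow> 'a \<Rightarrow> real"
  assumes M: "finite_measure M" and t: "t \<in> {a<..<b}"
    and int: "\<And>s. s \<in> {a<..<b} \<Longrightarrow> integrable M (g s)"
    and meas: "g' t \<in> borel_measurable M"
    and der: "\<And>s x. s \<in> {a<..<b} \<Longrightarrow> x \<in> space M \<Longrightarrow>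
      ((\<lambda>s. g s x) has_real_derivative g' s x) (at s)"
    and bd: "\<And>s x. s \<in> {a<..<b} \<Longrightarrow> x \<in> space M \<Longrightarrow> \<bar>g' s x\<bar> \<le> B"
  shows "((\<lambda>s. LINT x|M. g s x) has_real_derivative (LINT x|M. g' t x)) (at t)"
proof -
  let ?S = "{a<..<b}"
  have "((\<lambda>s. LINT x|M. (g s x - g t x) / (s - t)) \<longlongrightarrow> (LINT x|M. g' t x)) (at t within ?S)"
  proof (rule tendsto_integral_bounded[OF M, where B = B])
    show "(\<lambda>x. (g s x - g t x) / (s - t)) \<in> borel_measurable M" if "s \<in> ?S" for s
      using int[OF that] int[OF t] by auto
    show "((\<lambda>s. (g s x - g t x) / (s - t)) \<longlongrightarrow> g' t x) (at t within ?S)" if "x \<in> space M" for x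
      using has_field_derivative_at_within[OF der[OF t that]]
      unfolding has_field_derivative_iff .
    show "\<bar>(g s x - g t x) / (s - t)\<bar> \<le> B" if s: "s \<in> ?S" and x: "x \<in> space M" for s x
    proof -
      have "norm (g s x - g t x) \<le> B * norm (s - t)"
      proof (rule field_differentiable_bound)
        show "((\<lambda>s. g s x) has_real_derivative g' s x) (at s within ?S)" if "s \<in> ?S" for s
          using der[OF that x] by (rule has_field_derivative_at_within)
        show "norm (g' s x) \<le> B" if "s \<in> ?S" for s using bd[OF that x] by simp
      qed (use s t in auto)
      \<comment> \<open>Needed for s = t, where the quotient is 0 by the convention on division by
        zero.\<close>
      moreover have "0 \<le> B" using bd[OF s x] by linarith
      ultimately show ?thesis
        by (cases "s = t") (simp_all add: divide_le_eq)
    qed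
  qed fact
  moreover have "(LINT x|M. (g s x - g t x) / (s - t)) = ((LINT x|M. g s x) - (LINT x|M. g t x)) / (s - t)"
    if "s \<in> ?S" for s
    using int[OF that] int[OF t] by simp
  ultimately have "((\<lambda>s. ((LINT x|M. g s x) - (LINT x|M. g t x)) / (s - t)) \<longlongrightarrow> (LINT x|M. g' t x))
      (at t within ?S)"
    by (subst (asm) Lim_cong_within[OF refl refl refl]) auto
  then show ?thesis
    unfolding has_field_derivative_iff at_within_open[OF t open_greaterThanLessThan] .
qed

text \<open>E(s) exp(cs) is nonincreasing. The differential inequality is asked only for s > 0;
  continuity carries monotonicity down to s = 0.\<close>

lemma exponential_decay:
  fixes E E' :: "real \<Rightarrow> real"
  assumes cont: "continuous_on {0..t} E"
    and der: "\<And>s. s > 0 \<Longrightarrow> (E has_real_derivative E' s) (at s)"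
    and le: "\<And>s. s > 0 \<Longrightarrow> E' s \<le> - c * E s"
    and t: "t \<ge> 0"
  shows "E t \<le> E 0 * exp (- c * t)"
proof -
  from t have "E t * exp (c * t) \<le> E 0 * exp (c * 0)"
  proof (rule DERIV_nonpos_imp_decreasing_open[where f = "\<lambda>s. E s * exp (c * s)"])
    fix s :: real assume s: "0 < s" "s < t"
    have "((\<lambda>s. E s * exp (c * s)) has_real_derivative (E' s + c * E s) * exp (c * s)) (at s)"
      using der[OF s(1)] by (auto intro!: derivative_eq_intros simp: algebra_simps)
    moreover have "(E' s + c * E s) * exp (c * s) \<le> 0"
      using le[OF s(1)] by (intro mult_nonpos_nonneg) auto
    ultimately show "\<exists>y. ((\<lambda>s. E s * exp (c * s)) has_real_derivative y) (at s) \<and> y \<le> 0" by blast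
  next
    show "continuous_on {0..t} (\<lambda>s. E s * exp (c * s))"
      by (intro continuous_intros cont)
  qed
  then have "E t * exp (c * t) * exp (- c * t) \<le> E 0 * exp (- c * t)"
    by (intro mult_right_mono) auto
  then show ?thesis by (simp add: mult.assoc flip: exp_add)
qed

section \<open>Slices of functions of time and space\<close>

lemma has_derivative_slice:
  assumes "U differentiable (at (t, x))"
  shows "((\<lambda>y. U (t, y)) has_derivative (\<lambda>h. frechet_derivative U (at (t, x)) (0, h))) (at x)"
proof -
  have "((\<lambda>y. (t, y)) has_derivative (\<lambda>h. (0, h))) (at x)"
    by (intro has_derivative_Pair has_derivative_const has_derivative_ident)
  moreover have "(U has_derivative frechet_derivative U (at (t, x))) (at (t, x))"
    using assms unfolding frechet_derivative_works .
  ultimately show ?thesis using diff_chain_at by (force simp: comp_def)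
qed

lemma has_real_derivative_slice:
  fixes U :: "real \<times> 'a::real_normed_vector \<Rightarrow> real"
  assumes "U differentiable (at (t, x))"
  shows "((\<lambda>s. U (s, x)) has_real_derivative frechet_derivative U (at (t, x)) (1, 0)) (at t)"
proof -
  let ?D = "frechet_derivative U (at (t, x))"
  have "((\<lambda>s. (s, x)) has_derivative (\<lambda>h. (h, 0))) (at t)"
    by (intro has_derivative_Pair has_derivative_const has_derivative_ident)
  moreover have D: "(U has_derivative ?D) (at (t, x))"
    using assms unfolding frechet_derivative_works .
  ultimately have "((\<lambda>s. U (s, x)) has_derivative (\<lambda>h. ?D (h, 0))) (at t)"
    using diff_chain_at by (force simp: comp_def)
  moreover have "(\<lambda>h. ?D (h, 0)) = (*) (?D (1, 0))"
  proof
    fix h :: real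
    have "?D (h *\<^sub>R (1, 0)) = h *\<^sub>R ?D (1, 0)"
      using has_derivative_linear[OF D] by (rule linear_scale)
    then show "?D (h, 0) = ?D (1, 0) * h" by (simp add: mult.commute)
  qed
  ultimately show ?thesis by (simp add: has_field_derivative_def)
qed

lemma continuous_on_slice:
  assumes "continuous_on W U"
  shows "continuous_on {x. (t, x) \<in> W} (\<lambda>x. U (t, x))"
  using continuous_on_compose2[OF assms, of "{x. (t, x) \<in> W}" "\<lambda>x. (t, x)"]
  by (simp add: continuous_on_Pair subset_eq)

lemma open_slice:
  assumes "open W"
  shows "open {x. (t, x) \<in> W}"
proof -
  have "open ((\<lambda>x. (t, x)) -` W)"
    using assms by (intro open_vimage continuous_on_Pair continuous_on_const continuous_on_id)
  then show ?thesis by (simp add: vimage_def)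
qed

text \<open>A spatial partial derivative of a slice is the derivative of \<open>U\<close> in
  direction (0, b), itself a basis vector of the product space; the induction hypothesis applies to
  that derivative.\<close>

lemma Ck_on_slice:
  fixes U :: "real \<times> 'a::euclidean_space \<Rightarrow> 'b::real_normed_vector"
  assumes "open W" "Ck_on k W U"
  shows "Ck_on k {x. (t, x) \<in> W} (\<lambda>x. U (t, x))"
  using assms(2)
proof (induction k arbitrary: U)
  case 0
  then show ?case by (simp add: continuous_on_slice)
next
  case (Suc k)
  let ?V = "{x. (t, x) \<in> W}"
  have d: "((\<lambda>y. U (t, y)) has_derivative (\<lambda>h. frechet_derivative U (at (t, x)) (0, h))) (at x)"
    if "x \<in> ?V" for x
    using Suc.prems that by (intro has_derivative_slice) simp
  have "Ck_on k ?V (\<lambda>x. frechet_derivative (\<lambda>y. U (t, y)) (at x) b)" if "b \<in> Basis" for b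
  proof (rule Ck_on_cong[OF open_slice[OF assms(1)]])
    show "Ck_on k ?V (\<lambda>x. frechet_derivative U (at (t, x)) (0, b))"
      using Suc.prems that by (intro Suc.IH) (simp add: Basis_prod_def)
    show "frechet_derivative U (at (t, x)) (0, b) = frechet_derivative (\<lambda>y. U (t, y)) (at x) b"
      if "x \<in> ?V" for x
      using frechet_derivative_at[OF d[OF that]] by (rule fun_cong)
  qed
  then show ?case using d unfolding Ck_on.simps differentiable_def by blast
qed

section \<open>Entropy and dissipation\<close>

text \<open>On a domain of measure 1 the squared L^2 distance of f to its mean is the integral of
  f^2 minus the squared mean.\<close>

lemma poincare_variance:
  assumes \<Omega>: "open \<Omega>" "bounded \<Omega>" "measure lebesgue \<Omega> = 1"
    and n: "unit_exterior_normal \<Omega> \<sigma> \<nu>" and PW: "poincare_wirtinger \<Omega> C"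
    and V: "open V" "closure \<Omega> \<subseteq> V" and f: "Ck_on 1 V f"
  shows "(LINT x|lebesgue_on \<Omega>. (f x)\<^sup>2) - (LINT x|lebesgue_on \<Omega>. f x)\<^sup>2 \<le>
    C\<^sup>2 * (LINT x|lebesgue_on \<Omega>. (norm (grad f x))\<^sup>2)"
proof -
  let ?M = "lebesgue_on \<Omega>"
  define m where "m = (LINT x|?M. f x)"
  have S: "\<Omega> \<in> lmeasurable" using \<Omega> by (simp add: bounded_set_imp_lmeasurable)
  interpret finite_measure ?M using S by (simp add: finite_measure_lebesgue_on)
  have M1: "measure ?M \<Omega> = 1"
    using \<Omega>(3) S by (simp add: measure_restrict_space fmeasurableD)
  have fc: "continuous_on (closure \<Omega>) f"
    using Ck_on_1_continuous[OF f] V(2) by (rule continuous_on_subset)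
  have i: "integrable ?M f" and i2: "integrable ?M (\<lambda>x. (f x)\<^sup>2)"
    using fc by (simp_all add: integrable_lebesgue_on_continuous[OF \<Omega>(1,2)] continuous_on_power)
  have "L2_norm_on \<Omega> (\<lambda>x. f x - m) \<le> C * L2_norm_on \<Omega> (grad f)"
    using PW H1_with_gradient_Ck_on_1[OF \<Omega>(1,2) n V f] unfolding poincare_wirtinger_def m_def by blast
  moreover have "0 \<le> L2_norm_on \<Omega> (\<lambda>x. f x - m)" by (simp add: L2_norm_on_def)
  ultimately have "(L2_norm_on \<Omega> (\<lambda>x. f x - m))\<^sup>2 \<le> (C * L2_norm_on \<Omega> (grad f))\<^sup>2"
    by (rule power_mono)
  moreover have "(L2_norm_on \<Omega> (\<lambda>x. f x - m))\<^sup>2 = (LINT x|?M. (f x - m)\<^sup>2)"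
    by (simp add: L2_norm_on_def)
  moreover have "(LINT x|?M. (f x - m)\<^sup>2) = (LINT x|?M. (f x)\<^sup>2) - m\<^sup>2"
  proof -
    have "(LINT x|?M. (f x - m)\<^sup>2) = (LINT x|?M. (f x)\<^sup>2 - 2 * m * f x + m\<^sup>2)"
      by (intro Bochner_Integration.integral_cong) (simp_all add: power2_diff)
    also have "\<dots> = (LINT x|?M. (f x)\<^sup>2) - 2 * m * m + m\<^sup>2"
      using i i2 M1 by (simp add: m_def)
    finally show ?thesis by (simp add: power2_eq_square)
  qed
  ultimately show ?thesis by (simp add: L2_norm_on_def power_mult_distrib m_def)
qed

lemma poincare_variance_powr:
  assumes \<Omega>: "open \<Omega>" "bounded \<Omega>" "measure lebesgue \<Omega> = 1"
    and n: "unit_exterior_normal \<Omega> \<sigma> \<nu>" and PW: "poincare_wirtinger \<Omega> C"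
    and V: "open V" "closure \<Omega> \<subseteq> V" and v: "Ck_on 1 V v" "\<And>x. x \<in> V \<Longrightarrow> v x > 0"
  shows "(LINT x|lebesgue_on \<Omega>. v x powr (2 * s)) - (LINT x|lebesgue_on \<Omega>. v x powr s)\<^sup>2 \<le>
    C\<^sup>2 * s\<^sup>2 * (LINT x|lebesgue_on \<Omega>. v x powr (2 * s - 2) * (norm (grad v x))\<^sup>2)"
proof -
  have sub: "\<Omega> \<subseteq> V" using V closure_subset by blast
  have "(LINT x|lebesgue_on \<Omega>. (v x powr s)\<^sup>2) - (LINT x|lebesgue_on \<Omega>. v x powr s)\<^sup>2 \<le>
    C\<^sup>2 * (LINT x|lebesgue_on \<Omega>. (norm (grad (\<lambda>x. v x powr s) x))\<^sup>2)"
    using Ck_on_1_powr[OF v] by (rule poincare_variance[OF \<Omega> n PW V])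
  moreover have "(LINT x|lebesgue_on \<Omega>. (v x powr s)\<^sup>2) = (LINT x|lebesgue_on \<Omega>. v x powr (2 * s))"
    by (intro Bochner_Integration.integral_cong)
      (simp_all add: power2_eq_square flip: powr_add)
  moreover have "(LINT x|lebesgue_on \<Omega>. (norm (grad (\<lambda>x. v x powr s) x))\<^sup>2) =
      (LINT x|lebesgue_on \<Omega>. s\<^sup>2 * (v x powr (2 * s - 2) * (norm (grad v x))\<^sup>2))"
  proof (rule Bochner_Integration.integral_cong)
    fix x assume "x \<in> space (lebesgue_on \<Omega>)"
    then have x: "x \<in> V" using sub by auto
    then have "v differentiable (at x)" using v(1) by (simp add: Ck_on_1)
    moreover have "(v x powr (s - 1))\<^sup>2 = v x powr (2 * s - 2)"
      by (simp add: power2_eq_square flip: powr_add)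
    ultimately show "(norm (grad (\<lambda>x. v x powr s) x))\<^sup>2 =
        s\<^sup>2 * (v x powr (2 * s - 2) * (norm (grad v x))\<^sup>2)"
      using grad_powr[of v x s] v(2)[OF x] by (simp add: power_mult_distrib)
  qed simp
  ultimately show ?thesis by simp
qed

text \<open>The function v^s with s = (\<alpha>+1)/2 has v^(\<alpha>+1) as its square. Since
  \<alpha> \<le> 1 gives s \<le> 1, Jensen bounds the squared mean of v^s by the mass to the power
  \<alpha>+1, so the variance of v^s dominates (\<alpha>+1) times the entropy. The factor 4 cancels
  that in s^2 = (\<alpha>+1)^2/4.\<close>

lemma entropy_le_fisher:
  assumes \<Omega>: "open \<Omega>" "bounded \<Omega>" "measure lebesgue \<Omega> = 1"
    and n: "unit_exterior_normal \<Omega> \<sigma> \<nu>" and PW: "poincare_wirtinger \<Omega> C"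
    and V: "open V" "closure \<Omega> \<subseteq> V" and v: "Ck_on 1 V v" "\<And>x. x \<in> V \<Longrightarrow> v x > 0"
    and a: "0 < \<alpha>" "\<alpha> \<le> 1"
  shows "4 * entropy \<Omega> \<alpha> v \<le>
    C\<^sup>2 * (\<alpha> + 1) * (LINT x|lebesgue_on \<Omega>. v x powr (\<alpha> - 1) * (norm (grad v x))\<^sup>2)"
proof -
  let ?M = "lebesgue_on \<Omega>"
  have sub: "\<Omega> \<subseteq> V" using V closure_subset by blast
  have S: "\<Omega> \<in> lmeasurable" using \<Omega> by (simp add: bounded_set_imp_lmeasurable)
  have M: "finite_measure ?M" "measure ?M (space ?M) = 1"
    using S \<Omega>(3) by (simp_all add: finite_measure_lebesgue_on measure_restrict_space fmeasurableD)
  have pos: "v x > 0" if "x \<in> space ?M" for x using v(2) sub that by auto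
  have int: "integrable ?M (\<lambda>x. v x powr s)" for s
    using continuous_on_subset[OF Ck_on_1_continuous[OF Ck_on_1_powr[OF v]] V(2)]
    by (rule integrable_lebesgue_on_continuous[OF \<Omega>(1,2)])
  define s where "s = (\<alpha> + 1) / 2"
  have s2: "2 * s = \<alpha> + 1" by (simp add: s_def)
  have "(LINT x|?M. v x powr s) \<le> (LINT x|?M. v x powr 1) powr s"
    using a by (intro integral_powr_le_powr_integral[OF M pos int]) (auto simp: s_def)
  also have "(LINT x|?M. v x powr 1) = (LINT x|?M. v x)"
    using pos by (intro Bochner_Integration.integral_cong) (auto simp: less_imp_le)
  finally have "(LINT x|?M. v x powr s)\<^sup>2 \<le> ((LINT x|?M. v x) powr s)\<^sup>2"
    by (intro power_mono) auto
  also have "\<dots> = (LINT x|?M. v x) powr (\<alpha> + 1)"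
    by (simp add: power2_eq_square s2 flip: powr_add mult_2)
  finally have "(LINT x|?M. v x powr (\<alpha> + 1)) - (LINT x|?M. v x) powr (\<alpha> + 1) \<le>
      C\<^sup>2 * s\<^sup>2 * (LINT x|?M. v x powr (2 * s - 2) * (norm (grad v x))\<^sup>2)"
    using poincare_variance_powr[OF \<Omega> n PW V v, of s] s2 by simp
  also have "2 * s - 2 = \<alpha> - 1" using s2 by simp
  finally have "4 * (1 / (\<alpha> + 1) * ((LINT x|?M. v x powr (\<alpha> + 1)) - (LINT x|?M. v x) powr (\<alpha> + 1))) \<le>
      4 * (1 / (\<alpha> + 1) * (C\<^sup>2 * s\<^sup>2 * (LINT x|?M. v x powr (\<alpha> - 1) * (norm (grad v x))\<^sup>2)))"
    using a by (intro mult_left_mono) auto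
  also have "\<dots> = C\<^sup>2 * (4 * s\<^sup>2 / (\<alpha> + 1)) *
      (LINT x|?M. v x powr (\<alpha> - 1) * (norm (grad v x))\<^sup>2)" by simp
  also have "4 * s\<^sup>2 / (\<alpha> + 1) = \<alpha> + 1" using a by (simp add: s_def power2_eq_square)
  finally show ?thesis by (simp only: entropy_def)
qed

lemma mass_entropy_le_fisher:
  assumes \<Omega>: "open \<Omega>" "bounded \<Omega>" "measure lebesgue \<Omega> = 1"
    and n: "unit_exterior_normal \<Omega> \<sigma> \<nu>" and PW: "poincare_wirtinger \<Omega> C"
    and V: "open V" "closure \<Omega> \<subseteq> V" and v: "Ck_on 1 V v" "\<And>x. x \<in> V \<Longrightarrow> v x > 0"
    and a: "0 < \<alpha>" and b: "1 < \<beta>"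
  shows "4 * ((LINT x|lebesgue_on \<Omega>. v x) powr (\<beta> - 1) * ((\<alpha> + 1) * entropy \<Omega> \<alpha> v)) \<le>
    beckner_C' C ((\<alpha> + \<beta>) / 2) (2 * (\<alpha> + 1) / (\<alpha> + \<beta>)) * (\<alpha> + \<beta>)\<^sup>2 *
      (LINT x|lebesgue_on \<Omega>. v x powr (\<alpha> + \<beta> - 2) * (norm (grad v x))\<^sup>2)"
proof -
  let ?M = "lebesgue_on \<Omega>"
  define p where "p = (\<alpha> + \<beta>) / 2"
  define q where "q = 2 * (\<alpha> + 1) / (\<alpha> + \<beta>)"
  define D where "D = (LINT x|?M. v x powr (\<alpha> + \<beta> - 2) * (norm (grad v x))\<^sup>2)"
  define I where "I s = (LINT x|?M. v x powr s)" for s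
  have sub: "\<Omega> \<subseteq> V" using V closure_subset by blast
  have S: "\<Omega> \<in> lmeasurable" using \<Omega> by (simp add: bounded_set_imp_lmeasurable)
  have M: "finite_measure ?M" "measure ?M (space ?M) = 1"
    using S \<Omega>(3) by (simp_all add: finite_measure_lebesgue_on measure_restrict_space fmeasurableD)
  have pos: "v x > 0" if "x \<in> space ?M" for x using v(2) sub that by auto
  have int: "integrable ?M (\<lambda>x. v x powr s)" for s
    using continuous_on_subset[OF Ck_on_1_continuous[OF Ck_on_1_powr[OF v]] V(2)]
    by (rule integrable_lebesgue_on_continuous[OF \<Omega>(1,2)])
  \<comment> \<open>Since \<alpha> + \<beta> > 0, the bound q < 2 amounts to \<beta> > 1, and pq > 1
    to \<alpha> > 0.\<close>
  have p: "p > 0" and pq: "p * q = \<alpha> + 1" and q: "0 < q" "q < 2"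
    using a b by (simp_all add: p_def q_def field_simps)
  have I1: "I 1 = (LINT x|?M. v x)"
    unfolding I_def using pos by (intro Bochner_Integration.integral_cong) (auto simp: less_imp_le)
  have E: "(\<alpha> + 1) * entropy \<Omega> \<alpha> v = I (\<alpha> + 1) - I 1 powr (\<alpha> + 1)"
    using a by (simp add: entropy_def I1) (simp add: I_def)
  have jensen: "I 1 powr (\<alpha> + 1) \<le> I (\<alpha> + 1)"
    unfolding I_def using a by (intro powr_integral_le_integral_powr[OF M pos int]) auto
  have int': "integrable ?M (\<lambda>x. (v x powr p) powr s)" for s using int by (simp add: powr_powr)
  have pos': "v x powr p > 0" if "x \<in> space ?M" for x using pos[OF that] by simp
  \<comment> \<open>The choice f = v^p makes f^q, f^(1/p), f^2 and f equal to v^(\<alpha>+1), v,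
    v^(\<alpha>+\<beta>) and v^p.\<close>
  have "(LINT x|?M. (v x powr p) powr q) powr (2 / q - 1) * ((LINT x|?M. (v x powr p) powr q) -
        (LINT x|?M. (v x powr p) powr (1 / p)) powr (p * q))
      \<le> beckner_C' 1 p q * ((LINT x|?M. (v x powr p) powr 2) - (LINT x|?M. (v x powr p) powr 1)\<^sup>2)"
    using pq a q p by (intro beckner_variance[OF M pos' int']) auto
  then have "I (p * q) powr (2 / q - 1) * (I (p * q) - I (p * (1 / p)) powr (p * q))
      \<le> beckner_C' 1 p q * (I (p * 2) - (I (p * 1))\<^sup>2)"
    unfolding powr_powr I_def .
  then have "I (\<alpha> + 1) powr (2 / q - 1) * (I (\<alpha> + 1) - I 1 powr (\<alpha> + 1))
      \<le> beckner_C' 1 p q * (I (2 * p) - (I p)\<^sup>2)"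
    using p by (simp add: pq mult.commute)
  also have "\<dots> \<le> beckner_C' 1 p q * (C\<^sup>2 * p\<^sup>2 * D)"
  proof (rule mult_left_mono)
    have "I (2 * p) - (I p)\<^sup>2 \<le> C\<^sup>2 * p\<^sup>2 *
        (LINT x|?M. v x powr (2 * p - 2) * (norm (grad v x))\<^sup>2)"
      unfolding I_def by (rule poincare_variance_powr[OF \<Omega> n PW V v])
    also have "2 * p - 2 = \<alpha> + \<beta> - 2" by (simp add: p_def)
    finally show "I (2 * p) - (I p)\<^sup>2 \<le> C\<^sup>2 * p\<^sup>2 * D" by (simp add: D_def)
    show "0 \<le> beckner_C' 1 p q" using q a by (simp add: beckner_C'_def pq)
  qed
  \<comment> \<open>Both branches of the constant are proportional to C^2, and p^2 =
    (\<alpha>+\<beta>)^2/4 comes from the gradient of v^p.\<close>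
  also have "\<dots> = beckner_C' C p q * (\<alpha> + \<beta>)\<^sup>2 * D / 4"
    by (simp add: beckner_C'_def p_def power_divide)
  finally have *: "I (\<alpha> + 1) powr (2 / q - 1) * (I (\<alpha> + 1) - I 1 powr (\<alpha> + 1))
      \<le> beckner_C' C p q * (\<alpha> + \<beta>)\<^sup>2 * D / 4" .
  \<comment> \<open>The exponent identity (\<alpha>+1)(2/q - 1) = \<beta> - 1 lets Jensen replace
    the time-dependent prefactor by a power of the mass.\<close>
  have "I 1 powr (\<beta> - 1) = (I 1 powr (\<alpha> + 1)) powr (2 / q - 1)"
  proof -
    have "(\<alpha> + 1) * (2 / q - 1) = \<beta> - 1"
      using a b by (simp add: q_def field_simps)
    then show ?thesis by (simp add: powr_powr)
  qed
  also have "\<dots> \<le> I (\<alpha> + 1) powr (2 / q - 1)"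
    using jensen q by (intro powr_mono2) (auto simp: field_simps)
  finally have "I 1 powr (\<beta> - 1) * (I (\<alpha> + 1) - I 1 powr (\<alpha> + 1)) \<le>
      I (\<alpha> + 1) powr (2 / q - 1) * (I (\<alpha> + 1) - I 1 powr (\<alpha> + 1))"
    using jensen by (intro mult_right_mono) auto
  also note *
  finally have "I 1 powr (\<beta> - 1) * ((\<alpha> + 1) * entropy \<Omega> \<alpha> v) \<le>
      beckner_C' C p q * (\<alpha> + \<beta>)\<^sup>2 * D / 4" by (simp only: E)
  then have "4 * (I 1 powr (\<beta> - 1) * ((\<alpha> + 1) * entropy \<Omega> \<alpha> v)) \<le>
      beckner_C' C p q * (\<alpha> + \<beta>)\<^sup>2 * D" by linarith
  then show ?thesis by (simp only: I1 p_def q_def D_def)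
qed

section \<open>Smooth positive solutions\<close>

lemma smooth_positive_solutionD:
  assumes "smooth_positive_solution \<Omega> \<sigma> \<nu> \<beta> u\<^sub>0 u"
  shows "\<exists>W. open W \<and> {0<..} \<times> closure \<Omega> \<subseteq> W \<and> smooth_on W (\<lambda>(t, x). u t x)"
    and "continuous_on ({0..} \<times> closure \<Omega>) (\<lambda>(t, x). u t x)"
    and "\<And>t x. t > 0 \<Longrightarrow> x \<in> closure \<Omega> \<Longrightarrow> u t x > 0"
    and "\<And>x. x \<in> \<Omega> \<Longrightarrow> u 0 x > 0"
    and "\<And>t x. t > 0 \<Longrightarrow> x \<in> \<Omega> \<Longrightarrow>
      ((\<lambda>s. u s x) has_real_derivative laplacian (\<lambda>y. u t y powr \<beta>) x) (at t)"
    and "\<And>t. t > 0 \<Longrightarrow> AE x in \<sigma>. grad (\<lambda>y. u t y powr \<beta>) x \<bullet> \<nu> x = 0"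
    and "\<And>x. x \<in> \<Omega> \<Longrightarrow> u 0 x = u\<^sub>0 x"
  using assms unfolding smooth_positive_solution_def by (elim conjE; blast)+

text \<open>The calculus of powers needs positivity on an open neighbourhood, but u is positive only
  on the closure. Continuity allows the neighbourhood to be shrunk to the part where u(t) >
  0.\<close>

lemma solution_slice:
  assumes sol: "smooth_positive_solution \<Omega> \<sigma> \<nu> \<beta> u\<^sub>0 u" and t: "t > 0"
  obtains V where "open V" "closure \<Omega> \<subseteq> V" "Ck_on 2 V (u t)" "\<And>x. x \<in> V \<Longrightarrow> u t x > 0"
proof -
  obtain W where W: "open W" "{0<..} \<times> closure \<Omega> \<subseteq> W" "smooth_on W (\<lambda>(t, x). u t x)"
    using smooth_positive_solutionD(1)[OF sol] by blast
  let ?T = "{x. (t, x) \<in> W}"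
  have "Ck_on 2 ?T (\<lambda>x. (\<lambda>(t, x). u t x) (t, x))"
    using W(3) unfolding smooth_on_def by (intro Ck_on_slice W(1)) blast
  then have C2: "Ck_on 2 ?T (u t)" by simp
  have oT: "open ?T" using W(1) by (rule open_slice)
  have "continuous_on ?T (u t)" using Ck_on_1_continuous[OF Ck_on_2_grad(1)[OF C2]] .
  then have "open (?T \<inter> u t -` {0<..})"
    using oT by (rule continuous_open_preimage) simp
  moreover have "closure \<Omega> \<subseteq> ?T \<inter> u t -` {0<..}"
    using W(2) t smooth_positive_solutionD(3)[OF sol t] by auto
  moreover have "Ck_on 2 (?T \<inter> u t -` {0<..}) (u t)"
    using C2 by (rule Ck_on_subset) simp
  ultimately show ?thesis by (rule that) simp
qed

lemma solution_positive:
  assumes "smooth_positive_solution \<Omega> \<sigma> \<nu> \<beta> u\<^sub>0 u" "t \<ge> 0" "x \<in> \<Omega>"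
  shows "u t x > 0"
proof (cases "t = 0")
  case False
  then have "t > 0" using assms(2) by simp
  moreover have "x \<in> closure \<Omega>" using assms(3) closure_subset by blast
  ultimately show ?thesis by (rule smooth_positive_solutionD(3)[OF assms(1)])
qed (use smooth_positive_solutionD(4)[OF assms(1,3)] in simp)

text \<open>At t = 0 the solution may vanish on the boundary, so no positive lower bound is uniform
  in space. A nonnegative exponent needs only the upper bound, which compactness of [0,T] times the
  closure provides.\<close>

lemma solution_integral_powr_continuous:
  assumes \<Omega>: "open \<Omega>" "bounded \<Omega>" and sol: "smooth_positive_solution \<Omega> \<sigma> \<nu> \<beta> u\<^sub>0 u" and a: "a \<ge> 0"
  shows "continuous_on {0..T} (\<lambda>t. LINT x|lebesgue_on \<Omega>. u t x powr a)"
proof -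
  have S: "\<Omega> \<in> lmeasurable" using \<Omega> by (simp add: bounded_set_imp_lmeasurable)
  have c: "continuous_on ({0..} \<times> closure \<Omega>) (\<lambda>(t, x). u t x)"
    by (rule smooth_positive_solutionD(2)[OF sol])
  have "compact ({0..T} \<times> closure \<Omega>)"
    using \<Omega>(2) by (intro compact_Times) simp_all
  moreover have "continuous_on ({0..T} \<times> closure \<Omega>) (\<lambda>(t, x). u t x)"
    by (rule continuous_on_subset[OF c]) auto
  ultimately have "bounded ((\<lambda>(t, x). u t x) ` ({0..T} \<times> closure \<Omega>))"
    by (intro compact_imp_bounded compact_continuous_image)
  then obtain B where bd: "\<forall>y\<in>(\<lambda>(t, x). u t x) ` ({0..T} \<times> closure \<Omega>). norm y \<le> B"
    unfolding bounded_iff by blast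
  have B: "u t x \<le> B" if "t \<in> {0..T}" "x \<in> \<Omega>" for t x
  proof -
    have "(t, x) \<in> {0..T} \<times> closure \<Omega>" using that closure_subset[of \<Omega>] by blast
    from bspec[OF bd imageI[OF this]] show ?thesis by simp
  qed
  have ct: "continuous_on \<Omega> (u t)" if "t \<in> {0..T}" for t
  proof -
    have "continuous_on \<Omega> (\<lambda>x. (\<lambda>(t, x). u t x) (t, x))"
      using that closure_subset[of \<Omega>]
      by (intro continuous_on_compose2[OF c] continuous_on_Pair continuous_on_const continuous_on_id)
        auto
    then show ?thesis by simp
  qed
  have cx: "continuous_on {0..T} (\<lambda>t. u t x)" if "x \<in> \<Omega>" for x
  proof -
    have "continuous_on {0..T} (\<lambda>t. (\<lambda>(t, x). u t x) (t, x))"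
      using that closure_subset[of \<Omega>]
      by (intro continuous_on_compose2[OF c] continuous_on_Pair continuous_on_const continuous_on_id)
        auto
    then show ?thesis by simp
  qed
  show ?thesis
  proof (rule continuous_on_integral_bounded)
    show "finite_measure (lebesgue_on \<Omega>)" using S by (simp add: finite_measure_lebesgue_on)
    show "(\<lambda>x. u t x powr a) \<in> borel_measurable (lebesgue_on \<Omega>)" if t: "t \<in> {0..T}" for t
    proof (rule continuous_imp_measurable_on_sets_lebesgue)
      have "u t x \<noteq> 0" if "x \<in> \<Omega>" for x
        using solution_positive[OF sol _ that, of t] t by simp
      then show "continuous_on \<Omega> (\<lambda>x. u t x powr a)"
        by (intro continuous_on_powr ct[OF t] continuous_on_const) blast
    qed (use S in auto)
    show "\<bar>u t x powr a\<bar> \<le> B powr a" if "t \<in> {0..T}" "x \<in> space (lebesgue_on \<Omega>)" for t x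
    proof -
      have x: "x \<in> \<Omega>" using that(2) by simp
      have "u t x > 0" using solution_positive[OF sol _ x, of t] that(1) by simp
      then show ?thesis using B[OF that(1) x] a by (simp add: powr_mono2)
    qed
    show "continuous_on {0..T} (\<lambda>t. u t x powr a)" if "x \<in> space (lebesgue_on \<Omega>)" for x
    proof -
      have x: "x \<in> \<Omega>" using that by simp
      have "u t x \<noteq> 0" if "t \<in> {0..T}" for t
        using solution_positive[OF sol _ x, of t] that by simp
      then show ?thesis by (intro continuous_on_powr cx[OF x] continuous_on_const) blast
    qed
  qed
qed

text \<open>Differentiation under the integral produces (\<alpha>+1) times the integral of
  u^\<alpha> u_t; the equation replaces u_t and the energy identity does the rest.\<close>

lemma solution_integral_powr_derivative:
  assumes \<Omega>: "open \<Omega>" "bounded \<Omega>" and n: "unit_exterior_normal \<Omega> \<sigma> \<nu>"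
    and sol: "smooth_positive_solution \<Omega> \<sigma> \<nu> \<beta> u\<^sub>0 u" and t: "t > 0"
  shows "((\<lambda>t. LINT x|lebesgue_on \<Omega>. u t x powr (\<alpha> + 1)) has_real_derivative
    - ((\<alpha> + 1) * \<alpha> * \<beta> *
      (LINT x|lebesgue_on \<Omega>. u t x powr (\<alpha> + \<beta> - 2) * (norm (grad (u t) x))\<^sup>2))) (at t)"
proof -
  have S: "\<Omega> \<in> lmeasurable" using \<Omega> by (simp add: bounded_set_imp_lmeasurable)
  define U where "U = (\<lambda>(t, x). u t x)"
  obtain W where W: "open W" "{0<..} \<times> closure \<Omega> \<subseteq> W" "smooth_on W U"
    using smooth_positive_solutionD(1)[OF sol] unfolding U_def by blast
  note pos = smooth_positive_solutionD(3)[OF sol]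
  have U1: "Ck_on 1 W U" using W(3) unfolding smooth_on_def by blast
  have inW: "(s, x) \<in> W" if "s > 0" "x \<in> closure \<Omega>" for s x
    using W(2) that by auto
  have Ud: "U differentiable (at (s, x))" if "s > 0" "x \<in> closure \<Omega>" for s x
    using U1 inW[OF that] by (simp add: Ck_on_1)
  define T where "T z = frechet_derivative U (at z) (1, 0)" for z
  have "(1, 0) \<in> (Basis :: (real \<times> 'a) set)" by (simp add: Basis_prod_def)
  then have Tc: "continuous_on W T" unfolding T_def using U1 by (simp add: Ck_on_1)
  have uT: "((\<lambda>s. u s x) has_real_derivative T (s, x)) (at s)" if "s > 0" "x \<in> closure \<Omega>" for s x
    using has_real_derivative_slice[OF Ud[OF that]] by (simp add: U_def T_def)
  define G where "G z = (\<alpha> + 1) * (U z powr \<alpha> * T z)" for z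
  \<comment> \<open>A compact time window around t that avoids t = 0. There u is bounded away from
    zero and its time derivative is continuous, which gives the uniform bound
    \<open>B\<close>.\<close>
  let ?K = "{t/2..2*t} \<times> closure \<Omega>"
  have KW: "?K \<subseteq> W" using inW t by auto
  have Upos: "U z \<noteq> 0" if "z \<in> ?K" for z
  proof -
    obtain s x where z: "z = (s, x)" by (cases z)
    then have "s > 0" "x \<in> closure \<Omega>" using that t by auto
    then show ?thesis using pos[of s x] by (simp add: z U_def)
  qed
  have Gc: "continuous_on ?K G"
    unfolding G_def
    using continuous_on_subset[OF Ck_on_1_continuous[OF U1] KW] continuous_on_subset[OF Tc KW] Upos
    by (intro continuous_on_mult continuous_on_powr continuous_on_const) blast+
  have "compact ?K" using \<Omega>(2) by (intro compact_Times) simp_all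
  with Gc have "bounded (G ` ?K)" by (intro compact_imp_bounded compact_continuous_image)
  then obtain B where B: "\<And>z. z \<in> ?K \<Longrightarrow> norm (G z) \<le> B"
    unfolding bounded_iff by blast
  have cl: "x \<in> closure \<Omega>" if "x \<in> \<Omega>" for x using that closure_subset by blast
  have "((\<lambda>s. LINT x|lebesgue_on \<Omega>. u s x powr (\<alpha> + 1)) has_real_derivative
    (LINT x|lebesgue_on \<Omega>. G (t, x))) (at t)"
  proof (rule has_real_derivative_integral[where a = "t/2" and b = "2*t" and B = B
        and g' = "\<lambda>s x. G (s, x)"])
    show "finite_measure (lebesgue_on \<Omega>)" using S by (simp add: finite_measure_lebesgue_on)
    show "t \<in> {t/2<..<2*t}" using t by simp
    show "integrable (lebesgue_on \<Omega>) (\<lambda>x. u s x powr (\<alpha> + 1))" if "s \<in> {t/2<..<2*t}" for s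
    proof -
      have s: "s > 0" using that t by simp
      obtain V where V: "open V" "closure \<Omega> \<subseteq> V" "Ck_on 2 V (u s)" "\<And>x. x \<in> V \<Longrightarrow> u s x > 0"
        using solution_slice[OF sol s] by blast
      have "continuous_on V (\<lambda>x. u s x powr (\<alpha> + 1))"
        using Ck_on_1_continuous[OF Ck_on_1_powr[OF Ck_on_2_grad(1)[OF V(3)] V(4)]] .
      then show ?thesis
        using V(2) by (intro integrable_lebesgue_on_continuous[OF \<Omega>]) (rule continuous_on_subset)
    qed
    show "(\<lambda>x. G (t, x)) \<in> borel_measurable (lebesgue_on \<Omega>)"
    proof (rule continuous_imp_measurable_on_sets_lebesgue)
      show "continuous_on \<Omega> (\<lambda>x. G (t, x))"
        using t cl
        by (intro continuous_on_compose2[OF Gc] continuous_on_Pair continuous_on_const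
            continuous_on_id) auto
    qed (use S in auto)
    show "((\<lambda>s. u s x powr (\<alpha> + 1)) has_real_derivative G (s, x)) (at s)"
      if "s \<in> {t/2<..<2*t}" "x \<in> space (lebesgue_on \<Omega>)" for s x
    proof -
      have x: "x \<in> closure \<Omega>" and s: "s > 0" using that cl t by auto
      have "((\<lambda>s. u s x powr (\<alpha> + 1)) has_real_derivative
          (\<alpha> + 1) * u s x powr (\<alpha> + 1 - of_nat 1) * T (s, x)) (at s)"
        using uT[OF s x] pos[OF s x] by (rule DERIV_fun_powr)
      then show ?thesis by (simp add: G_def U_def mult.assoc)
    qed
    show "\<bar>G (s, x)\<bar> \<le> B" if "s \<in> {t/2<..<2*t}" "x \<in> space (lebesgue_on \<Omega>)" for s x
      using B[of "(s, x)"] that cl by simp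
  qed
  moreover have "(LINT x|lebesgue_on \<Omega>. G (t, x)) =
    - ((\<alpha> + 1) * \<alpha> * \<beta> *
      (LINT x|lebesgue_on \<Omega>. u t x powr (\<alpha> + \<beta> - 2) * (norm (grad (u t) x))\<^sup>2))"
  proof -
    obtain V where V: "open V" "closure \<Omega> \<subseteq> V" "Ck_on 2 V (u t)" "\<And>x. x \<in> V \<Longrightarrow> u t x > 0"
      using solution_slice[OF sol t] by blast
    have "(LINT x|lebesgue_on \<Omega>. G (t, x)) =
      (LINT x|lebesgue_on \<Omega>. (\<alpha> + 1) * (u t x powr \<alpha> * laplacian (\<lambda>y. u t y powr \<beta>) x))"
    proof (rule Bochner_Integration.integral_cong)
      fix x assume "x \<in> space (lebesgue_on \<Omega>)"
      then have x: "x \<in> \<Omega>" by simp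
      \<comment> \<open>The time derivative is known twice: as a partial derivative of
        \<open>U\<close>, which is continuous up to the boundary, and inside the domain as the
        Laplacian in the equation.\<close>
      from DERIV_unique[OF uT[OF t cl[OF x]] smooth_positive_solutionD(5)[OF sol t x]]
      show "G (t, x) = (\<alpha> + 1) * (u t x powr \<alpha> * laplacian (\<lambda>y. u t y powr \<beta>) x)"
        by (simp add: G_def U_def)
    qed simp
    also have "\<dots> = (\<alpha> + 1) *
        - (\<alpha> * \<beta> * (LINT x|lebesgue_on \<Omega>. u t x powr (\<alpha> + \<beta> - 2) * (norm (grad (u t) x))\<^sup>2))"
      using energy_identity[OF \<Omega> n V smooth_positive_solutionD(6)[OF sol t], of \<alpha>] by simp
    finally show ?thesis by simp
  qed
  ultimately show ?thesis by simp
qed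

section \<open>Conservation of mass and the entropy along a solution\<close>

lemma solution_integral_powr_1:
  assumes "smooth_positive_solution \<Omega> \<sigma> \<nu> \<beta> u\<^sub>0 u" "t \<ge> 0"
  shows "(LINT x|lebesgue_on \<Omega>. u t x powr 1) = (LINT x|lebesgue_on \<Omega>. u t x)"
  using solution_positive[OF assms] by (intro Bochner_Integration.integral_cong) (auto simp: less_imp_le)

text \<open>The factor \<alpha> in the derivative of the integral of u^(\<alpha>+1) vanishes at
  \<alpha> = 0; continuity then includes the initial time.\<close>

lemma solution_mass:
  assumes \<Omega>: "open \<Omega>" "bounded \<Omega>" and n: "unit_exterior_normal \<Omega> \<sigma> \<nu>"
    and sol: "smooth_positive_solution \<Omega> \<sigma> \<nu> \<beta> u\<^sub>0 u" and t: "t \<ge> 0"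
  shows "(LINT x|lebesgue_on \<Omega>. u t x) = (LINT x|lebesgue_on \<Omega>. u 0 x)"
proof (cases "t = 0")
  case False
  with t have "t > 0" by simp
  then have "(LINT x|lebesgue_on \<Omega>. u t x powr 1) = (LINT x|lebesgue_on \<Omega>. u 0 x powr 1)"
  proof (rule DERIV_isconst_end[where f = "\<lambda>t. LINT x|lebesgue_on \<Omega>. u t x powr 1"])
    show "continuous_on {0..t} (\<lambda>t. LINT x|lebesgue_on \<Omega>. u t x powr 1)"
      by (rule solution_integral_powr_continuous[OF \<Omega> sol]) simp
    show "((\<lambda>t. LINT x|lebesgue_on \<Omega>. u t x powr 1) has_real_derivative 0) (at s)" if "0 < s" for s
      using solution_integral_powr_derivative[OF \<Omega> n sol that, of 0]
      by (simp only: add_0 mult_zero_right mult_zero_left minus_zero)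
  qed
  then show ?thesis using solution_integral_powr_1[OF sol] t by simp
qed simp

lemma entropy_cong:
  assumes "\<And>x. x \<in> \<Omega> \<Longrightarrow> v x = w x"
  shows "entropy \<Omega> \<alpha> v = entropy \<Omega> \<alpha> w"
proof -
  have "(LINT x|lebesgue_on \<Omega>. v x powr (\<alpha> + 1)) = (LINT x|lebesgue_on \<Omega>. w x powr (\<alpha> + 1))"
    and "(LINT x|lebesgue_on \<Omega>. v x) = (LINT x|lebesgue_on \<Omega>. w x)"
    using assms by (intro Bochner_Integration.integral_cong; simp)+
  then show ?thesis by (simp only: entropy_def)
qed

lemma solution_entropy_derivative:
  assumes \<Omega>: "open \<Omega>" "bounded \<Omega>" and n: "unit_exterior_normal \<Omega> \<sigma> \<nu>"
    and sol: "smooth_positive_solution \<Omega> \<sigma> \<nu> \<beta> u\<^sub>0 u" and t: "t > 0" and a: "\<alpha> > 0"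
  shows "((\<lambda>t. entropy \<Omega> \<alpha> (u t)) has_real_derivative
    - (\<alpha> * \<beta> * (LINT x|lebesgue_on \<Omega>. u t x powr (\<alpha> + \<beta> - 2) * (norm (grad (u t) x))\<^sup>2))) (at t)"
proof -
  let ?D = "LINT x|lebesgue_on \<Omega>. u t x powr (\<alpha> + \<beta> - 2) * (norm (grad (u t) x))\<^sup>2"
  \<comment> \<open>By conservation of mass the subtracted term of the entropy is frozen at its
    initial value, so only the power integral is differentiated.\<close>
  let ?m = "(LINT x|lebesgue_on \<Omega>. u 0 x) powr (\<alpha> + 1)"
  have "((\<lambda>t. 1 / (\<alpha> + 1) * ((LINT x|lebesgue_on \<Omega>. u t x powr (\<alpha> + 1)) - ?m)) has_real_derivative
      1 / (\<alpha> + 1) * (- ((\<alpha> + 1) * \<alpha> * \<beta> * ?D) - 0)) (at t)"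
    by (intro DERIV_cmult DERIV_diff DERIV_const solution_integral_powr_derivative[OF \<Omega> n sol t])
  moreover have "1 / (\<alpha> + 1) * (- ((\<alpha> + 1) * \<alpha> * \<beta> * ?D) - 0) = - (\<alpha> * \<beta> * ?D)"
    using a by simp
  ultimately have "((\<lambda>t. 1 / (\<alpha> + 1) * ((LINT x|lebesgue_on \<Omega>. u t x powr (\<alpha> + 1)) - ?m))
      has_real_derivative - (\<alpha> * \<beta> * ?D)) (at t)" by simp
  then show ?thesis
  proof (rule has_field_derivative_transform_within_open[where S = "{0<..}"])
    show "1 / (\<alpha> + 1) * ((LINT x|lebesgue_on \<Omega>. u s x powr (\<alpha> + 1)) - ?m) = entropy \<Omega> \<alpha> (u s)"
      if "s \<in> {0<..}" for s
      using solution_mass[OF \<Omega> n sol, of s] that by (simp add: entropy_def)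
  qed (use t in auto)
qed

text \<open>Reduces each decay rate \<open>c\<close> to one static inequality between entropy and
  dissipation at every positive time.\<close>

lemma solution_entropy_decay:
  assumes \<Omega>: "open \<Omega>" "bounded \<Omega>" and n: "unit_exterior_normal \<Omega> \<sigma> \<nu>"
    and sol: "smooth_positive_solution \<Omega> \<sigma> \<nu> \<beta> u\<^sub>0 u" and a: "\<alpha> > 0"
    and le: "\<And>t. t > 0 \<Longrightarrow> c * entropy \<Omega> \<alpha> (u t) \<le>
      \<alpha> * \<beta> * (LINT x|lebesgue_on \<Omega>. u t x powr (\<alpha> + \<beta> - 2) * (norm (grad (u t) x))\<^sup>2)"
    and t: "t \<ge> 0"
  shows "entropy \<Omega> \<alpha> (u t) \<le> entropy \<Omega> \<alpha> u\<^sub>0 * exp (- c * t)"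
proof -
  let ?m = "(LINT x|lebesgue_on \<Omega>. u 0 x) powr (\<alpha> + 1)"
  have "entropy \<Omega> \<alpha> (u t) \<le> entropy \<Omega> \<alpha> (u 0) * exp (- c * t)"
  proof (rule exponential_decay[OF _ _ _ t])
    have "continuous_on {0..t}
        (\<lambda>t. 1 / (\<alpha> + 1) * ((LINT x|lebesgue_on \<Omega>. u t x powr (\<alpha> + 1)) - ?m))"
      using a by (intro continuous_on_mult continuous_on_diff continuous_on_const
          solution_integral_powr_continuous[OF \<Omega> sol]) simp
    then show "continuous_on {0..t} (\<lambda>t. entropy \<Omega> \<alpha> (u t))"
    proof (rule continuous_on_eq)
      show "1 / (\<alpha> + 1) * ((LINT x|lebesgue_on \<Omega>. u s x powr (\<alpha> + 1)) - ?m) = entropy \<Omega> \<alpha> (u s)"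
        if "s \<in> {0..t}" for s
        using solution_mass[OF \<Omega> n sol, of s] that by (simp add: entropy_def)
    qed
    show "((\<lambda>t. entropy \<Omega> \<alpha> (u t)) has_real_derivative
      - (\<alpha> * \<beta> * (LINT x|lebesgue_on \<Omega>. u s x powr (\<alpha> + \<beta> - 2) * (norm (grad (u s) x))\<^sup>2))) (at s)"
      if "s > 0" for s
      using solution_entropy_derivative[OF \<Omega> n sol that a] .
    show "- (\<alpha> * \<beta> * (LINT x|lebesgue_on \<Omega>. u s x powr (\<alpha> + \<beta> - 2) * (norm (grad (u s) x))\<^sup>2))
        \<le> - c * entropy \<Omega> \<alpha> (u s)" if "s > 0" for s
      using le[OF that] by simp
  qed
  moreover have "entropy \<Omega> \<alpha> (u 0) = entropy \<Omega> \<alpha> u\<^sub>0"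
    by (intro entropy_cong smooth_positive_solutionD(7)[OF sol])
  ultimately show ?thesis by simp
qed

section \<open>Entropy decay\<close>

text \<open>Transfers the maximum principle to powers: the lower bound on y serves for s > 0 and the
  upper bound for s < 0, where the power reverses the order.\<close>

lemma INF_powr_le:
  fixes f :: "'a \<Rightarrow> real"
  assumes "A \<noteq> {}" and pos: "\<And>x. x \<in> A \<Longrightarrow> f x > 0" and y: "y > 0"
    and bd: "(INF x\<in>A. f x) \<le> y" "y \<le> (SUP x\<in>A. f x)"
  shows "(INF x\<in>A. f x powr s) \<le> y powr s"
proof (rule ccontr)
  define I where "I = (INF x\<in>A. f x powr s)"
  assume "\<not> (INF x\<in>A. f x powr s) \<le> y powr s"
  then have yI: "y powr s < I" by (simp add: I_def)
  have "y powr s > 0" using y by simp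
  \<comment> \<open>The infimum of the powers could be 0 in general; arguing by contradiction makes
    it positive, so that it can be raised to 1/s strictly monotonically.\<close>
  with yI have I: "I > 0" by linarith
  have "bdd_below ((\<lambda>x. f x powr s) ` A)" by (rule bdd_belowI2[where m = 0]) simp
  then have If: "I \<le> f x powr s" if "x \<in> A" for x
    unfolding I_def using that by (rule cINF_lower)
  have f: "(f x powr s) powr (1 / s) = f x" if "x \<in> A" "s \<noteq> 0" for x
    using pos[OF that(1)] that(2) by (simp add: powr_powr)
  have y': "(y powr s) powr (1 / s) = y" if "s \<noteq> 0"
    using y that by (simp add: powr_powr)
  consider "s = 0" | "s > 0" | "s < 0" by linarith
  then show False
  proof cases
    case 1
    obtain x where "x \<in> A" using assms(1) by blast
    from If[OF this] pos[OF this] have "I \<le> 1" using 1 by simp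
    then show False using yI y 1 by simp
  next
    case 2
    have "I powr (1 / s) \<le> f x" if "x \<in> A" for x
      using powr_mono2[of "1 / s" I "f x powr s"] If[OF that] f[OF that] I 2 by simp
    then have "I powr (1 / s) \<le> (INF x\<in>A. f x)" using assms(1) by (intro cINF_greatest)
    moreover have "y < I powr (1 / s)"
      using powr_less_mono2[of "1 / s" "y powr s" I] yI y' 2 by simp
    ultimately show False using bd(1) by linarith
  next
    case 3
    \<comment> \<open>Since 1/s < 0, the lower bound on the powers becomes an upper bound on f,
      hence on its supremum.\<close>
    have "f x \<le> I powr (1 / s)" if "x \<in> A" for x
      using powr_mono2'[of "1 / s" I "f x powr s"] If[OF that] f[OF that] I 3 by simp
    then have "(SUP x\<in>A. f x) \<le> I powr (1 / s)" using assms(1) by (intro cSUP_least)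
    moreover have "I powr (1 / s) < y"
      using powr_less_mono2_neg[of "1 / s" "y powr s" I] yI y' y 3 by simp
    ultimately show False using bd(2) by linarith
  qed
qed

lemma beckner_C'_pos:
  assumes "C > 0" "0 < q" "q < 2" "p * q > 1"
  shows "beckner_C' C p q > 0"
  using assms by (simp add: beckner_C'_def)

lemma entropy_decay_pointwise_bound:
  assumes \<Omega>: "open \<Omega>" "bounded \<Omega>" "measure lebesgue \<Omega> = 1"
    and n: "unit_exterior_normal \<Omega> \<sigma> \<nu>" and PW: "poincare_wirtinger \<Omega> C" and C: "C > 0"
    and a: "0 < \<alpha>" "\<alpha> \<le> 1" and b: "\<beta> > 0"
    and sol: "smooth_positive_solution \<Omega> \<sigma> \<nu> \<beta> u\<^sub>0 u"
    and m: "m \<ge> 0" "\<And>t x. t > 0 \<Longrightarrow> x \<in> \<Omega> \<Longrightarrow> m \<le> u t x powr (\<beta> - 1)" and t: "t \<ge> 0"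
  shows "entropy \<Omega> \<alpha> (u t) \<le>
    entropy \<Omega> \<alpha> u\<^sub>0 * exp (- (4 * \<alpha> * \<beta> / (C\<^sup>2 * (\<alpha> + 1)) * m) * t)"
proof (rule solution_entropy_decay[OF \<Omega>(1,2) n sol a(1) _ t])
  fix t :: real assume t: "t > 0"
  let ?M = "lebesgue_on \<Omega>"
  obtain V where V: "open V" "closure \<Omega> \<subseteq> V" "Ck_on 2 V (u t)" "\<And>x. x \<in> V \<Longrightarrow> u t x > 0"
    using solution_slice[OF sol t] by blast
  note v1 = Ck_on_2_grad(1)[OF V(3)]
  define D where "D s = (LINT x|?M. u t x powr s * (norm (grad (u t) x))\<^sup>2)" for s
  have int: "integrable ?M (\<lambda>x. u t x powr s * (norm (grad (u t) x))\<^sup>2)" for s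
    using continuous_on_subset[OF continuous_on_grad[OF v1] V(2)]
      continuous_on_subset[OF Ck_on_1_continuous[OF Ck_on_1_powr[OF v1 V(4)]] V(2)]
    by (intro integrable_lebesgue_on_continuous[OF \<Omega>(1,2)] continuous_on_mult continuous_on_power
        continuous_on_norm)
  \<comment> \<open>Splitting u^(\<alpha>+\<beta>-2) as u^(\<beta>-1) u^(\<alpha>-1) and bounding
    the first factor by \<open>m\<close> leaves the dissipation of the case \<beta> = 1.\<close>
  have "m * D (\<alpha> - 1) = (LINT x|?M. m * (u t x powr (\<alpha> - 1) * (norm (grad (u t) x))\<^sup>2))"
    unfolding D_def by simp
  also have "\<dots> \<le> D (\<alpha> + \<beta> - 2)"
    unfolding D_def
  proof (rule integral_mono)
    fix x assume "x \<in> space ?M"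
    then have x: "x \<in> \<Omega>" by simp
    have "m * (u t x powr (\<alpha> - 1) * (norm (grad (u t) x))\<^sup>2) \<le>
        u t x powr (\<beta> - 1) * (u t x powr (\<alpha> - 1) * (norm (grad (u t) x))\<^sup>2)"
      using m(2)[OF t x] by (intro mult_right_mono) simp_all
    also have "\<dots> = u t x powr (\<alpha> + \<beta> - 2) * (norm (grad (u t) x))\<^sup>2"
      by (simp add: add.commute flip: mult.assoc powr_add)
    finally show "m * (u t x powr (\<alpha> - 1) * (norm (grad (u t) x))\<^sup>2) \<le>
        u t x powr (\<alpha> + \<beta> - 2) * (norm (grad (u t) x))\<^sup>2" .
  qed (use int in auto)
  finally have mD: "m * D (\<alpha> - 1) \<le> D (\<alpha> + \<beta> - 2)" .
  have E: "4 * entropy \<Omega> \<alpha> (u t) \<le> C\<^sup>2 * (\<alpha> + 1) * D (\<alpha> - 1)"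
    unfolding D_def by (rule entropy_le_fisher[OF \<Omega> n PW V(1,2) v1 V(4) a])
  have "4 * \<alpha> * \<beta> / (C\<^sup>2 * (\<alpha> + 1)) * m * entropy \<Omega> \<alpha> (u t) =
      \<alpha> * \<beta> * m / (C\<^sup>2 * (\<alpha> + 1)) * (4 * entropy \<Omega> \<alpha> (u t))" by simp
  also have "\<dots> \<le> \<alpha> * \<beta> * m / (C\<^sup>2 * (\<alpha> + 1)) * (C\<^sup>2 * (\<alpha> + 1) * D (\<alpha> - 1))"
    using a b m(1) by (intro mult_left_mono E) simp
  also have "\<dots> = \<alpha> * \<beta> * (m * D (\<alpha> - 1))" using C a by simp
  also have "\<dots> \<le> \<alpha> * \<beta> * D (\<alpha> + \<beta> - 2)"
    using a b mD by (intro mult_left_mono) simp_all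
  finally show "4 * \<alpha> * \<beta> / (C\<^sup>2 * (\<alpha> + 1)) * m * entropy \<Omega> \<alpha> (u t) \<le> \<alpha> * \<beta> *
      (LINT x|?M. u t x powr (\<alpha> + \<beta> - 2) * (norm (grad (u t) x))\<^sup>2)"
    by (simp only: D_def)
qed

lemma entropy_decay_mass:
  assumes \<Omega>: "open \<Omega>" "bounded \<Omega>" "measure lebesgue \<Omega> = 1"
    and n: "unit_exterior_normal \<Omega> \<sigma> \<nu>" and PW: "poincare_wirtinger \<Omega> C" and C: "C > 0"
    and a: "0 < \<alpha>" and b: "\<beta> > 1"
    and sol: "smooth_positive_solution \<Omega> \<sigma> \<nu> \<beta> u\<^sub>0 u" and t: "t \<ge> 0"
  shows "entropy \<Omega> \<alpha> (u t) \<le> entropy \<Omega> \<alpha> u\<^sub>0 *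
    exp (- (4 * \<alpha> * \<beta> * (\<alpha> + 1) /
        (beckner_C' C ((\<alpha> + \<beta>) / 2) (2 * (\<alpha> + 1) / (\<alpha> + \<beta>)) * (\<alpha> + \<beta>)\<^sup>2) *
        (LINT x|lebesgue_on \<Omega>. \<bar>u\<^sub>0 x\<bar>) powr (\<beta> - 1)) * t)"
proof (rule solution_entropy_decay[OF \<Omega>(1,2) n sol a _ t])
  fix t :: real assume t: "t > 0"
  let ?M = "lebesgue_on \<Omega>" and ?E = "entropy \<Omega> \<alpha> (u t)"
  obtain V where V: "open V" "closure \<Omega> \<subseteq> V" "Ck_on 2 V (u t)" "\<And>x. x \<in> V \<Longrightarrow> u t x > 0"
    using solution_slice[OF sol t] by blast
  define K where "K = beckner_C' C ((\<alpha> + \<beta>) / 2) (2 * (\<alpha> + 1) / (\<alpha> + \<beta>)) * (\<alpha> + \<beta>)\<^sup>2"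
  define N where "N = (LINT x|?M. \<bar>u\<^sub>0 x\<bar>) powr (\<beta> - 1)"
  define D where "D = (LINT x|?M. u t x powr (\<alpha> + \<beta> - 2) * (norm (grad (u t) x))\<^sup>2)"
  have "beckner_C' C ((\<alpha> + \<beta>) / 2) (2 * (\<alpha> + 1) / (\<alpha> + \<beta>)) > 0"
  proof (rule beckner_C'_pos[OF C])
    have "(\<alpha> + \<beta>) / 2 * (2 * (\<alpha> + 1) / (\<alpha> + \<beta>)) = \<alpha> + 1"
      using a b by (simp add: field_simps)
    then show "(\<alpha> + \<beta>) / 2 * (2 * (\<alpha> + 1) / (\<alpha> + \<beta>)) > 1" using a by simp
  qed (use a b in \<open>simp_all add: field_simps\<close>)
  then have K: "K > 0" using a b by (simp add: K_def)
  \<comment> \<open>Positivity of the datum identifies its L^1 norm with the initial mass, and so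
    with the mass at time t.\<close>
  have "(LINT x|?M. \<bar>u\<^sub>0 x\<bar>) = (LINT x|?M. u 0 x)"
  proof (rule Bochner_Integration.integral_cong)
    fix x assume "x \<in> space ?M"
    then have x: "x \<in> \<Omega>" by simp
    show "\<bar>u\<^sub>0 x\<bar> = u 0 x"
      using smooth_positive_solutionD(4,7)[OF sol x] by simp
  qed simp
  also have "\<dots> = (LINT x|?M. u t x)"
    using solution_mass[OF \<Omega>(1,2) n sol, of t] t by simp
  finally have N: "N = (LINT x|?M. u t x) powr (\<beta> - 1)" by (simp add: N_def)
  have E: "4 * (N * ((\<alpha> + 1) * ?E)) \<le> K * D"
    unfolding N K_def D_def
    by (rule mass_entropy_le_fisher[OF \<Omega> n PW V(1,2) Ck_on_2_grad(1)[OF V(3)] V(4) a b])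
  have "4 * \<alpha> * \<beta> * (\<alpha> + 1) / K * N * ?E = \<alpha> * \<beta> / K * (4 * (N * ((\<alpha> + 1) * ?E)))" by simp
  also have "\<dots> \<le> \<alpha> * \<beta> / K * (K * D)"
    using a b K by (intro mult_left_mono E) simp
  also have "\<dots> = \<alpha> * \<beta> * D" using K by simp
  finally show "4 * \<alpha> * \<beta> * (\<alpha> + 1) /
      (beckner_C' C ((\<alpha> + \<beta>) / 2) (2 * (\<alpha> + 1) / (\<alpha> + \<beta>)) * (\<alpha> + \<beta>)\<^sup>2) *
      (LINT x|?M. \<bar>u\<^sub>0 x\<bar>) powr (\<beta> - 1) * ?E \<le> \<alpha> * \<beta> *
      (LINT x|?M. u t x powr (\<alpha> + \<beta> - 2) * (norm (grad (u t) x))\<^sup>2)"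
    by (simp only: K_def N_def D_def)
qed

theorem theorem6:
  fixes \<Omega> :: "'a::euclidean_space set"
    and \<sigma> :: "'a measure" and \<nu> :: "'a \<Rightarrow> 'a"
    and C\<^sub>P \<alpha> \<beta> :: real
    and u\<^sub>0 :: "'a \<Rightarrow> real" and u :: "real \<Rightarrow> 'a \<Rightarrow> real"
  assumes "bounded_domain \<Omega>" and "measure lebesgue \<Omega> = 1"
    and "unit_exterior_normal \<Omega> \<sigma> \<nu>"
    and "C\<^sub>P > 0" and "poincare_wirtinger \<Omega> C\<^sub>P"
    and "0 < \<alpha>" and "\<alpha> \<le> 1" and "\<beta> > 0"
    and "Linf_on \<Omega> u\<^sub>0" and "(INF x\<in>\<Omega>. u\<^sub>0 x) \<ge> 0"
    and "smooth_positive_solution \<Omega> \<sigma> \<nu> \<beta> u\<^sub>0 u"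
    and "\<And>t x. t \<ge> 0 \<Longrightarrow> x \<in> \<Omega> \<Longrightarrow> (INF y\<in>\<Omega>. u\<^sub>0 y) \<le> u t x \<and> u t x \<le> (SUP y\<in>\<Omega>. u\<^sub>0 y)"
  shows "(let \<Lambda> = 4 * \<alpha> * \<beta> / (beckner_C2 C\<^sub>P ((\<alpha> + 1) / 2) * (\<alpha> + 1)) *
                    (INF x\<in>\<Omega>. u\<^sub>0 x powr (\<beta> - 1))
          in \<Lambda> \<ge> 0 \<and> (\<forall>t\<ge>0. entropy \<Omega> \<alpha> (u t) \<le> entropy \<Omega> \<alpha> u\<^sub>0 * exp (- \<Lambda> * t))) \<and>
         (\<beta> > 1 \<longrightarrow>
         (let p = (\<alpha> + \<beta>) / 2; q = 2 * (\<alpha> + 1) / (\<alpha> + \<beta>);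
              \<Lambda> = 4 * \<alpha> * \<beta> * (\<alpha> + 1) / (beckner_C' C\<^sub>P p q * (\<alpha> + \<beta>)\<^sup>2) *
                    (LINT x|lebesgue_on \<Omega>. \<bar>u\<^sub>0 x\<bar>) powr (\<beta> - 1)
          in \<forall>t\<ge>0. entropy \<Omega> \<alpha> (u t) \<le> entropy \<Omega> \<alpha> u\<^sub>0 * exp (- \<Lambda> * t)))"
proof -
  have \<Omega>: "open \<Omega>" "bounded \<Omega>" "\<Omega> \<noteq> {}" using assms(1) by (simp_all add: bounded_domain_def)
  note dom = \<Omega>(1,2) assms(2,3,5,4)
  note sol = assms(11)
  let ?m = "INF x\<in>\<Omega>. u\<^sub>0 x powr (\<beta> - 1)"
  have pos: "u\<^sub>0 x > 0" if "x \<in> \<Omega>" for x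
    using smooth_positive_solutionD(4,7)[OF sol that] by simp
  have m: "?m \<ge> 0" using \<Omega>(3) by (intro cINF_greatest) simp_all
  \<comment> \<open>For \<beta> < 1 the exponent is negative, and it is the upper half of the
    maximum principle that gives this bound.\<close>
  have m_le: "?m \<le> u t x powr (\<beta> - 1)" if "t > 0" "x \<in> \<Omega>" for t x
    using assms(12)[of t x] solution_positive[OF sol, of t x] that
    by (intro INF_powr_le \<Omega>(3) pos) simp_all
  show ?thesis
    unfolding Let_def beckner_C2_def
    using entropy_decay_pointwise_bound[OF dom assms(6-8) sol m m_le]
      entropy_decay_mass[OF dom assms(6) _ sol] m assms(6,8)
    by (intro conjI allI impI) auto
qed

end
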